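(* The following congruences hold. (i) For any integer $a\ge1$ and any positive integer $M$ with $M\mid 2^{a+2}-3$, for all integers $n\ge0$ and for $t=1$ or $2$, $$\overline{p}_e(4^{a+1}n+t\,4^a)\equiv\overline{p}_o(4^{a+1}n+t\,4^a)\pmod M.$$ (ii) For any integer $a\ge1$ and any positive integer $M$ with $M\mid 2^{a+1}-1$, for all integers $n\ge0$, $$\overline{p}_e(2\cdot4^{a+1}n+3\cdot4^a)\equiv\overline{p}_o(2\cdot4^{a+1}n+3\cdot4^a)\pmod M.$$
   Context: An overpartition of $n$ is a partition of $n$ in which the first occurrence of each number may be overlined. The rank of an overpartition is its largest part minus its number of parts. $\overline{p}_e(n)$ (resp. $\overline{p}_o(n)$) denotes the number of overpartitions of $n$ with even (resp. odd) rank. *)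

theory Defs
  imports "HOL-Library.Multiset" "HOL-Number_Theory.Cong"
begin

text \<open>
  Only the first occurrence of a number may be overlined, so an overpartition is determined by
  its multiset of parts together with the set of those numbers whose first occurrence is
  overlined. It is encoded as this pair; the multiset contains every part, overlined or not.
\<close>

definition overpartitions :: "nat \<Rightarrow> (nat multiset \<times> nat set) set" where
  "overpartitions n =
     {(P, L). 0 \<notin># P \<and> sum_mset P = n \<and> L \<subseteq> set_mset P}"

text \<open>
  Inserting \<open>0\<close> only matters for the empty overpartition, whose rank is thereby \<open>0\<close>.
\<close>

definition overpartition_rank :: "nat multiset \<times> nat set \<Rightarrow> int" where
  "overpartition_rank p =
     int (Max (insert 0 (set_mset (fst p)))) - int (size (fst p))"

definition pbar_e :: "nat \<Rightarrow> nat" where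
  "pbar_e n = card {p \<in> overpartitions n. even (overpartition_rank p)}"

definition pbar_o :: "nat \<Rightarrow> nat" where
  "pbar_o n = card {p \<in> overpartitions n. odd (overpartition_rank p)}"

lemma finite_overpartitions: "finite (overpartitions n)"
proof (rule finite_subset)
  let ?A = "mset ` {xs. set xs \<subseteq> {..n} \<and> length xs \<le> n} \<times> Pow {..n}"
  show "finite ?A"
    by (simp add: finite_lists_length_le)
  show "overpartitions n \<subseteq> ?A"
  proof
    fix p assume "p \<in> overpartitions n"
    then obtain P L where p: "p = (P, L)" and P: "0 \<notin># P" "sum_mset P = n" "L \<subseteq> set_mset P"
      by (auto simp: overpartitions_def)
    have le: "set_mset P \<subseteq> {..n}"
      using P(2) by (auto dest: multi_member_split)
    have "size P \<le> sum_mset P"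
      using P(1) by (induction P) auto
    moreover obtain xs where xs: "mset xs = P"
      using ex_mset by blast
    ultimately have "xs \<in> {xs. set xs \<subseteq> {..n} \<and> length xs \<le> n}"
      using le P(2) by auto
    then show "p \<in> ?A"
      using p xs le P(3) by auto
  qed
qed

end

theory Submission
  imports Defs "HOL-Computational_Algebra.Formal_Power_Series"
begin

text \<open>
  Let \<open>F\<close> be the generating function of \<open>pbar_e n - pbar_o n\<close>. Sorting overpartitions by largest
  part gives \<open>F = 1 + (\<Sum>m\<ge>1. (-1)^m (u\<^sub>m - u\<^bsub>m-1\<^esub>))\<close> with
  \<open>u\<^sub>m = (\<Prod>i=1..m. (1 - q^i) / (1 + q^i))\<close>. A Bailey-type telescoping turns this into
  \<open>\<theta> F = 1 + 8 (\<Sum>r\<ge>1. (-1)^r q^(r^2+r) / (1 + q^r)^2)\<close> with \<open>\<theta> = (\<Sum>r. (-1)^r q^(r^2))\<close>, where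
  the sum runs over all integers.

  The same product arises from a Hecke-type double sum: with \<open>c k = (1 + q^(2k)) / (1 - q^(2k))\<close>,
  completing the square in
  \<open>\<theta> (\<Sum>\<bar>j\<bar>\<le>N. (-1)^(N+j) q^(N^2-j^2))\<close> produces terms \<open>c (N - l)\<close>, and the addition formula
  \<open>c N c (N - l) = 1 + c l (c (N - l) - c N)\<close> of the hyperbolic cotangent makes the sum over \<open>N\<close>
  telescope. Cancelling \<open>\<theta>\<close>, \<open>pbar_e n - pbar_o n\<close> is up to sign twice the number of solutions of
  \<open>x y + y z + z x = n\<close> in natural numbers with \<open>x\<close> and \<open>y\<close> of equal parity, solutions with all
  entries positive being counted twice.

  Passing to sublattices of index two of the corresponding binary quadratic forms gives recurrences
  from \<open>n\<close> to \<open>4 n\<close> for the numbers of solutions with prescribed parities, and these produce the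
  factors \<open>2^(a+2) - 3\<close> and \<open>2^(a+1) - 1\<close>.
\<close>

text \<open>A triple holds the Selling parameters of the form
  \<open>x X^2 + y Y^2 + z (X - Y)^2\<close> of determinant \<open>x y + y z + z x\<close>, so the
  weighted counts behave like class numbers. Under \<open>n\<close> to \<open>4 n\<close> the pair
  (same parity, mixed parity) becomes (same + 3 mixed, 2 mixed). After \<open>a\<close> steps the
  wanted total is same + \<open>(2^(a+2) - 3)\<close> mixed; residues where same vanishes give the
  first factor, those where same equals mixed give twice the second. The series \<open>F\<close> is
  not a product, so it is not compared with the double sum directly: multiplied by theta each
  becomes an explicit Lambert series, and these two differ by a series that vanishes by an
  elementary identity for sums over divisors and odd divisors. One coefficient needs only
  congruences modulo \<open>q^(n+1)\<close>, so all sums are finite. Those over \<open>N\<close>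
  stop at \<open>2 n\<close>: telescoping leaves a window of \<open>2 m\<close> values of
  \<open>c\<close> at the upper end, with \<open>m\<close> at most \<open>n\<close>, and all of them
  must already be congruent to 1. The \<open>- 2\<close> in the summand \<open>c N\<close> times
  \<open>hecke N\<close> minus 2 removes its limit, without which the sum over \<open>N\<close>
  would not converge.\<close>

section \<open>Solutions of \<open>x y + y z + z x = n\<close> by parity\<close>

text \<open>A zero entry puts the associated form on the boundary of the reduction domain, where it is
  counted with half the weight of an interior one.\<close>

definition wt :: "nat \<Rightarrow> nat \<Rightarrow> nat \<Rightarrow> int" where
  "wt x y z = 2 - of_bool (x = 0) - of_bool (y = 0) - of_bool (z = 0)"

definition triples :: "nat \<Rightarrow> (nat \<Rightarrow> nat \<Rightarrow> nat \<Rightarrow> bool) \<Rightarrow> (nat \<times> nat \<times> nat) set" where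
  "triples n P = {(x, y, z). x * y + y * z + z * x = n \<and> P x y z}"

definition wcount :: "nat \<Rightarrow> (nat \<Rightarrow> nat \<Rightarrow> nat \<Rightarrow> bool) \<Rightarrow> int" where
  "wcount n P = (\<Sum>(x, y, z) \<in> triples n P. wt x y z)"

text \<open>For positive \<open>n\<close> at most one entry is zero, so each entry occurs with a
  positive partner in some product. For \<open>n = 0\<close> the triples \<open>(x, 0, 0)\<close>
  are already infinitely many.\<close>

lemma triples_le:
  assumes "(x, y, z) \<in> triples n P" "n > 0"
  shows "x \<le> n" "y \<le> n" "z \<le> n"
proof -
  have le: "x \<le> x * y + y * z + z * x" if "0 < x * y + y * z + z * x" for x y z :: nat
  proof (cases "y = 0")
    case False
    then have "x * 1 \<le> x * y" by (intro mult_left_mono) auto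
    then show ?thesis by linarith
  next
    case True
    with that have "1 * x \<le> z * x" by (intro mult_right_mono) auto
    then show ?thesis by linarith
  qed
  have "x * y + y * z + z * x = n"
    using assms(1) by (simp add: triples_def)
  then show "x \<le> n" "y \<le> n" "z \<le> n"
    using le [of x y z] le [of y z x] le [of z x y] assms(2) by (simp_all add: add_ac)
qed

lemma finite_triples [simp]: "n > 0 \<Longrightarrow> finite (triples n P)"
  by (rule finite_subset [of _ "{..n} \<times> {..n} \<times> {..n}"]) (auto dest: triples_le)

lemma wcount_cong:
  "(\<And>x y z. x * y + y * z + z * x = n \<Longrightarrow> P x y z \<longleftrightarrow> Q x y z) \<Longrightarrow> wcount n P = wcount n Q"
  unfolding wcount_def by (rule sum.cong) (auto simp: triples_def)

lemma wcount_empty: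
  "(\<And>x y z. x * y + y * z + z * x = n \<Longrightarrow> \<not> P x y z) \<Longrightarrow> wcount n P = 0"
  unfolding wcount_def by (rule sum.neutral) (auto simp: triples_def)

lemma wcount_disj:
  assumes "n > 0"
    and "\<And>x y z. P x y z \<longleftrightarrow> A x y z \<or> B x y z" and "\<And>x y z. \<not> (A x y z \<and> B x y z)"
  shows "wcount n P = wcount n A + wcount n B"
proof -
  have "triples n P = triples n A \<union> triples n B" "triples n A \<inter> triples n B = {}"
    using assms(2,3) by (auto simp: triples_def)
  then show ?thesis
    unfolding wcount_def using assms(1) by (simp add: sum.union_disjoint)
qed

lemma wcount_swap12: "wcount n P = wcount n (\<lambda>x y z. P y x z)"
  unfolding wcount_def
  by (rule sum.reindex_bij_witness [of _ "\<lambda>(x, y, z). (y, x, z)" "\<lambda>(x, y, z). (y, x, z)"])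
     (auto simp: triples_def wt_def algebra_simps)

lemma wcount_swap23: "wcount n P = wcount n (\<lambda>x y z. P x z y)"
  unfolding wcount_def
  by (rule sum.reindex_bij_witness [of _ "\<lambda>(x, y, z). (x, z, y)" "\<lambda>(x, y, z). (x, z, y)"])
     (auto simp: triples_def wt_def algebra_simps)

lemma wcount_swap13: "wcount n P = wcount n (\<lambda>x y z. P z y x)"
  unfolding wcount_def
  by (rule sum.reindex_bij_witness [of _ "\<lambda>(x, y, z). (z, y, x)" "\<lambda>(x, y, z). (z, y, x)"])
     (auto simp: triples_def wt_def algebra_simps)

definition same_parity :: "nat \<Rightarrow> int" where
  "same_parity n = wcount n (\<lambda>x y z. (even x \<longleftrightarrow> even y) \<and> (even y \<longleftrightarrow> even z))"

text \<open>The first entry is the one of deviating parity. By symmetry of the equation and of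
  \<open>wt\<close>, the choice of position does not affect the count.\<close>

definition mixed_parity :: "nat \<Rightarrow> int" where
  "mixed_parity n = wcount n (\<lambda>x y z. (even x \<longleftrightarrow> odd y) \<and> (even y \<longleftrightarrow> even z))"

lemma mixed_parity_12:
  "wcount n (\<lambda>x y z. (even x \<longleftrightarrow> even y) \<and> (even y \<longleftrightarrow> odd z)) = mixed_parity n"
  unfolding mixed_parity_def by (subst wcount_swap13) (rule wcount_cong, auto)

lemma mixed_parity_13:
  "wcount n (\<lambda>x y z. (even x \<longleftrightarrow> odd y) \<and> (even y \<longleftrightarrow> odd z)) = mixed_parity n"
  unfolding mixed_parity_def by (subst wcount_swap12) (rule wcount_cong, auto)

lemma wcount_parity_12:
  "n > 0 \<Longrightarrow> wcount n (\<lambda>x y z. even x \<longleftrightarrow> even y) = same_parity n + mixed_parity n"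
  unfolding same_parity_def mixed_parity_12 [symmetric] by (rule wcount_disj) auto

lemma wcount_all:
  assumes "n > 0"
  shows "wcount n (\<lambda>x y z. True) = same_parity n + 3 * mixed_parity n"
proof -
  have "wcount n (\<lambda>x y z. True) = wcount n (\<lambda>x y z. even x \<longleftrightarrow> even y) + wcount n (\<lambda>x y z. even x \<longleftrightarrow> odd y)"
    by (rule wcount_disj [OF assms]) auto
  also have "wcount n (\<lambda>x y z. even x \<longleftrightarrow> odd y) = mixed_parity n
      + wcount n (\<lambda>x y z. (even x \<longleftrightarrow> odd y) \<and> (even y \<longleftrightarrow> odd z))"
    unfolding mixed_parity_def by (rule wcount_disj [OF assms]) auto
  finally show ?thesis
    using assms by (simp add: mixed_parity_13 wcount_parity_12)
qed

text \<open>If \<open>x\<close> and \<open>z\<close> differ in parity, \<open>y\<close> agrees with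
  exactly one of them, so two of the three mixed patterns occur.\<close>

lemma wcount_parity_13:
  assumes "n > 0"
  shows "wcount n (\<lambda>x y z. even x \<longleftrightarrow> odd z) = 2 * mixed_parity n"
proof -
  have "wcount n (\<lambda>x y z. even x \<longleftrightarrow> odd z)
    = wcount n (\<lambda>x y z. (even x \<longleftrightarrow> odd y) \<and> (even y \<longleftrightarrow> even z))
      + wcount n (\<lambda>x y z. (even x \<longleftrightarrow> even y) \<and> (even y \<longleftrightarrow> odd z))"
    by (rule wcount_disj [OF assms]) auto
  then show ?thesis
    by (simp add: mixed_parity_12 mixed_parity_def [symmetric])
qed

text \<open>Three odd entries have an odd value, so for \<open>4 * n\<close> all entries are even;
  halving them reaches every triple for \<open>n\<close>, and \<open>wt\<close> only looks at
  zeros.\<close>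

lemma same_parity_mult_4:
  assumes "n > 0"
  shows "same_parity (4 * n) = same_parity n + 3 * mixed_parity n"
proof -
  have "odd (x * y + y * z + z * x)" if "odd x" "odd y" "odd z" for x y z :: nat
    using that by simp
  then have "same_parity (4 * n) = wcount (4 * n) (\<lambda>x y z. even x \<and> even y \<and> even z)"
    unfolding same_parity_def by (intro wcount_cong) (metis dvd_triv_left even_mult_iff even_numeral)
  also have "\<dots> = wcount n (\<lambda>x y z. True)"
    unfolding wcount_def
    by (rule sum.reindex_bij_witness [of _ "\<lambda>(x, y, z). (2 * x, 2 * y, 2 * z)" "\<lambda>(x, y, z). (x div 2, y div 2, z div 2)"])
       (auto simp: triples_def wt_def elim!: evenE)
  finally show ?thesis
    using wcount_all [OF assms] by simp
qed

text \<open>The bijections in the next lemma pass from a binary quadratic form to the one on a sublattice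
  of index two, both in Selling-reduced coordinates.\<close>

lemma wcount_odd_even_even:
  fixes n :: nat
  shows "wcount (4 * n) (\<lambda>x y z. odd x \<and> even y \<and> even z \<and> y < z)
           = wcount n (\<lambda>p q r. (even p \<longleftrightarrow> odd r) \<and> q > 0 \<and> p < r)"
    and "wcount (4 * n) (\<lambda>x y z. odd x \<and> even y \<and> y = z)
           = 2 * wcount n (\<lambda>p q r. (even p \<longleftrightarrow> odd r) \<and> q = 0 \<and> p < r)"
proof -
  \<comment> \<open>With \<open>y = 2 b\<close>, \<open>z = 2 c\<close> the equation forces
    \<open>x (b + c)\<close> to be even; as \<open>x\<close> is odd, \<open>b\<close> and
    \<open>c\<close> have equal parity.\<close>
  have 4: "\<exists>d. z = y + 4 * d" if h: "odd x" "even y" "even z" "y < z" "x * y + y * z + z * x = 4 * n" for x y z :: nat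
  proof -
    obtain b where "y = 2 * b" using h(2) by (rule evenE)
    moreover obtain c where "z = 2 * c" using h(3) by (rule evenE)
    ultimately have bc: "y = 2 * b" "z = 2 * c" by auto
    then have "2 * (x * (b + c)) + 4 * (b * c) = 4 * n"
      using h(5) by (simp add: algebra_simps)
    then have "x * (b + c) + 2 * (b * c) = 2 * n" by simp
    then have "even (x * (b + c) + 2 * (b * c))" by simp
    then have "even (b + c)" using h(1) by simp
    then have "even (c - b)" "b \<le> c" using h(4) bc by auto
    from this(1) obtain d where "c - b = 2 * d" by (rule evenE)
    with \<open>b \<le> c\<close> have "c = b + 2 * d" by simp
    then show ?thesis using bc by (intro exI [of _ d]) simp
  qed
  show "wcount (4 * n) (\<lambda>x y z. odd x \<and> even y \<and> even z \<and> y < z)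
           = wcount n (\<lambda>p q r. (even p \<longleftrightarrow> odd r) \<and> q > 0 \<and> p < r)"
    unfolding wcount_def
  \<comment> \<open>Substituting \<open>x = r - p\<close>, \<open>y = 2 p\<close>,
    \<open>z = 2 p + 4 q\<close> gives \<open>x y + y z + z x = 4 (p q + q r + r p)\<close>.\<close>
  proof (rule sum.reindex_bij_witness [of _ "\<lambda>(p, q, r). (r - p, 2 * p, 4 * q + 2 * p)"
        "\<lambda>(x, y, z). (y div 2, (z - y) div 4, x + y div 2)"])
    fix t assume t: "t \<in> triples (4 * n) (\<lambda>x y z. odd x \<and> even y \<and> even z \<and> y < z)"
    obtain x y z where xyz: "t = (x, y, z)" by (cases t)
    with t have h: "odd x" "even y" "even z" "y < z" "x * y + y * z + z * x = 4 * n"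
      by (auto simp: triples_def)
    then obtain b where b: "y = 2 * b" by (auto elim!: evenE)
    obtain d where d: "z = y + 4 * d" using 4 [OF h] by blast
    then have d0: "d > 0" using h by auto
    have "b * d + d * (x + b) + (x + b) * b = n"
      using h(5) unfolding d b by (simp add: algebra_simps)
    then have img: "(case t of (x, y, z) \<Rightarrow> (y div 2, (z - y) div 4, x + y div 2)) = (b, d, x + b)"
      "b * d + d * (x + b) + (x + b) * b = n"
      by (simp_all add: xyz d b)
    show "(case (case t of (x, y, z) \<Rightarrow> (y div 2, (z - y) div 4, x + y div 2)) of
        (p, q, r) \<Rightarrow> (r - p, 2 * p, 4 * q + 2 * p)) = t"
      unfolding img by (simp add: xyz d b)
    show "(case t of (x, y, z) \<Rightarrow> (y div 2, (z - y) div 4, x + y div 2))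
        \<in> triples n (\<lambda>p q r. (even p \<longleftrightarrow> odd r) \<and> q > 0 \<and> p < r)"
      unfolding img triples_def using img(2) d0 h(1) by (auto simp: odd_pos)
    show "(case (case t of (x, y, z) \<Rightarrow> (y div 2, (z - y) div 4, x + y div 2)) of (x, y, z) \<Rightarrow> wt x y z)
        = (case t of (x, y, z) \<Rightarrow> wt x y z)"
      unfolding img using d0 h(1) by (auto simp: xyz d b wt_def)
  next
    fix t assume t: "t \<in> triples n (\<lambda>p q r. (even p \<longleftrightarrow> odd r) \<and> q > 0 \<and> p < r)"
    obtain p q r where "t = (p, q, r)" by (cases t)
    moreover define e where "e = r - p"
    ultimately have pqr: "t = (p, q, p + e)" "odd e" "q > 0" "p * q + q * (p + e) + (p + e) * p = n"
      using t by (auto simp: triples_def)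
    then show "(case (case t of (p, q, r) \<Rightarrow> (r - p, 2 * p, 4 * q + 2 * p)) of
        (x, y, z) \<Rightarrow> (y div 2, (z - y) div 4, x + y div 2)) = t"
      by simp
    show "(case t of (p, q, r) \<Rightarrow> (r - p, 2 * p, 4 * q + 2 * p))
        \<in> triples (4 * n) (\<lambda>x y z. odd x \<and> even y \<and> even z \<and> y < z)"
      using pqr by (auto simp: triples_def algebra_simps)
  qed
  \<comment> \<open>For \<open>y = z\<close> the same substitution lands on \<open>q = 0\<close>,
    where the weight has halved; the factor 2 restores it.\<close>
  show "wcount (4 * n) (\<lambda>x y z. odd x \<and> even y \<and> y = z)
           = 2 * wcount n (\<lambda>p q r. (even p \<longleftrightarrow> odd r) \<and> q = 0 \<and> p < r)"
    unfolding wcount_def sum_distrib_left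
  proof (rule sum.reindex_bij_witness [of _ "\<lambda>(p, q, r). (r - p, 2 * p, 2 * p)"
        "\<lambda>(x, y, z). (y div 2, 0, x + y div 2)"])
    fix t assume t: "t \<in> triples (4 * n) (\<lambda>x y z. odd x \<and> even y \<and> y = z)"
    obtain x y z where xyz: "t = (x, y, z)" by (cases t)
    with t have h: "odd x" "even y" "z = y" "x * y + y * y + y * x = 4 * n"
      by (auto simp: triples_def)
    from h(2) obtain b where b: "y = 2 * b" by (rule evenE)
    have img: "(case t of (x, y, z) \<Rightarrow> (y div 2, 0, x + y div 2)) = (b, 0, x + b)" "(x + b) * b = n"
      using h by (simp_all add: xyz b algebra_simps)
    show "(case (case t of (x, y, z) \<Rightarrow> (y div 2, 0, x + y div 2)) of (p, q, r) \<Rightarrow> (r - p, 2 * p, 2 * p)) = t"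
      unfolding img by (simp add: xyz h b)
    show "(case t of (x, y, z) \<Rightarrow> (y div 2, 0, x + y div 2))
      \<in> triples n (\<lambda>p q r. (even p \<longleftrightarrow> odd r) \<and> q = 0 \<and> p < r)"
      unfolding img(1) triples_def using img(2) h(1) by (simp add: odd_pos)
    show "2 * (case (case t of (x, y, z) \<Rightarrow> (y div 2, 0, x + y div 2)) of (x, y, z) \<Rightarrow> wt x y z)
       = (case t of (x, y, z) \<Rightarrow> wt x y z)"
      unfolding img(1) using odd_pos [OF h(1)] by (auto simp: xyz h b wt_def)
  next
    fix t assume t: "t \<in> triples n (\<lambda>p q r. (even p \<longleftrightarrow> odd r) \<and> q = 0 \<and> p < r)"
    obtain p q r where "t = (p, q, r)" by (cases t)
    moreover define e where "e = r - p"
    ultimately have pqr: "t = (p, 0, p + e)" "odd e" "(p + e) * p = n"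
      using t by (auto simp: triples_def)
    then show "(case (case t of (p, q, r) \<Rightarrow> (r - p, 2 * p, 2 * p)) of (x, y, z) \<Rightarrow> (y div 2, 0, x + y div 2)) = t"
      by simp
    show "(case t of (p, q, r) \<Rightarrow> (r - p, 2 * p, 2 * p)) \<in> triples (4 * n) (\<lambda>x y z. odd x \<and> even y \<and> y = z)"
      using pqr by (auto simp: triples_def algebra_simps)
  qed
qed


text \<open>Two odd entries and an even one have an odd value, so for \<open>4 * n\<close> exactly
  one entry is odd. The cases \<open>y < z\<close>, \<open>z < y\<close>, \<open>y = z\<close>
  correspond to the pieces of the count over \<open>even p \<longleftrightarrow> odd r\<close>,
  which is twice the mixed count.\<close>

lemma mixed_parity_mult_4:
  assumes "n > 0"
  shows "mixed_parity (4 * n) = 2 * mixed_parity n"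
proof -
  have n4: "4 * n > 0" using assms by simp
  let ?l = "\<lambda>x y z. odd x \<and> even y \<and> even z \<and> y < z"
  let ?g = "\<lambda>x y z. odd x \<and> even y \<and> even z \<and> z < y"
  let ?e = "\<lambda>x y z. odd x \<and> even y \<and> y = z"
  let ?L = "\<lambda>p q r. (even p \<longleftrightarrow> odd r) \<and> q > 0 \<and> p < r"
  let ?G = "\<lambda>p q r. (even p \<longleftrightarrow> odd r) \<and> q > 0 \<and> r < p"
  let ?Zl = "\<lambda>p q r. (even p \<longleftrightarrow> odd r) \<and> q = 0 \<and> p < r"
  let ?Zg = "\<lambda>p q r. (even p \<longleftrightarrow> odd r) \<and> q = 0 \<and> r < p"
  have "odd (x * y + y * z + z * x)" if "even x" "odd y" "odd z" for x y z :: nat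
    using that by simp
  then have "mixed_parity (4 * n) = wcount (4 * n) (\<lambda>x y z. odd x \<and> even y \<and> even z)"
    unfolding mixed_parity_def by (intro wcount_cong) (metis dvd_triv_left even_mult_iff even_numeral)
  also have "\<dots> = wcount (4 * n) (\<lambda>x y z. ?l x y z \<or> ?g x y z) + wcount (4 * n) ?e"
    by (rule wcount_disj [OF n4]) auto
  also have "wcount (4 * n) (\<lambda>x y z. ?l x y z \<or> ?g x y z) = wcount (4 * n) ?l + wcount (4 * n) ?g"
    by (rule wcount_disj [OF n4]) auto
  also have "wcount (4 * n) ?g = wcount (4 * n) ?l"
    by (subst wcount_swap23) (rule wcount_cong, auto)
  finally have 1: "mixed_parity (4 * n) = wcount n ?L + wcount n ?L + 2 * wcount n ?Zl"
    unfolding wcount_odd_even_even .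
  have "2 * mixed_parity n = wcount n (\<lambda>x y z. even x \<longleftrightarrow> odd z)"
    using wcount_parity_13 [OF assms] ..
  also have "\<dots> = wcount n (\<lambda>x y z. ?L x y z \<or> ?G x y z) + wcount n (\<lambda>x y z. ?Zl x y z \<or> ?Zg x y z)"
  proof (rule wcount_disj [OF assms])
    fix x y z :: nat
    \<comment> \<open>Opposite parities exclude \<open>x = z\<close>, so no diagonal piece is left
      over.\<close>
    have "(even x \<longleftrightarrow> odd z) \<Longrightarrow> x < z \<or> z < x"
      by (metis linorder_neqE_nat)
    then show "(even x \<longleftrightarrow> odd z) \<longleftrightarrow> (?L x y z \<or> ?G x y z) \<or> (?Zl x y z \<or> ?Zg x y z)"
      by (cases "y = 0") (simp_all, blast+)
  qed auto
  also have "wcount n (\<lambda>x y z. ?L x y z \<or> ?G x y z) = wcount n ?L + wcount n ?G"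
    by (rule wcount_disj [OF assms]) auto
  also have "wcount n (\<lambda>x y z. ?Zl x y z \<or> ?Zg x y z) = wcount n ?Zl + wcount n ?Zg"
    by (rule wcount_disj [OF assms]) auto
  also have "wcount n ?G = wcount n ?L"
    by (subst wcount_swap13) (rule wcount_cong, auto)
  also have "wcount n ?Zg = wcount n ?Zl"
    by (subst wcount_swap13) (rule wcount_cong, auto)
  finally show ?thesis
    using 1 by simp
qed

section \<open>Starting values: residues 1 and 2 modulo 4, and 3 modulo 8\<close>

lemma mod_4_mult_odd: "odd x \<Longrightarrow> odd y \<Longrightarrow> x * y mod 4 = (if x mod 4 = y mod 4 then 1 else 3 :: nat)"
proof -
  assume "odd x" "odd y"
  then have "x mod 4 = 1 \<or> x mod 4 = 3" "y mod 4 = 1 \<or> y mod 4 = 3"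
    by presburger+
  then show ?thesis
    using mod_mult_eq [of x 4 y] by auto
qed

lemma mod_4_eq_2: "k mod 4 = 2 \<Longrightarrow> \<exists>d. k = 2 * d \<and> odd d" for k :: nat
  by (rule exI [of _ "k div 2"]) presburger

text \<open>Three even entries give a value 0 modulo 4, three odd ones a value 3 modulo 4.\<close>

lemma same_parity_eq_0:
  assumes "n mod 4 = 1 \<or> n mod 4 = 2"
  shows "same_parity n = 0"
  unfolding same_parity_def
proof (rule wcount_empty)
  fix x y z assume n: "x * y + y * z + z * x = n"
  show "\<not> ((even x \<longleftrightarrow> even y) \<and> (even y \<longleftrightarrow> even z))"
  proof
    assume *: "(even x \<longleftrightarrow> even y) \<and> (even y \<longleftrightarrow> even z)"
    show False
    proof (cases "even x")
      case True
      then have "4 dvd x * y" "4 dvd y * z" "4 dvd z * x"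
        using * mult_dvd_mono [of 2 _ 2] by auto
      then have "4 dvd n"
        using n by (metis dvd_add)
      then show False using assms by auto
    next
      case False
      with * obtain a b c where "x = 2 * a + 1" "y = 2 * b + 1" "z = 2 * c + 1"
        by (meson oddE)
      then have "n = 4 * (a * b + b * c + c * a + a + b + c) + 3"
        using n by (simp add: algebra_simps)
      then have "n mod 4 = 3" by presburger
      then show False using assms by simp
    qed
  qed
qed

lemma mod_8_eq_3_imp_mod_4: "n mod 8 = 3 \<Longrightarrow> n mod 4 = 3" for n :: nat
  using mod_mod_cancel [of 4 8 n] by simp

lemma mod_4_add_even_mult:
  fixes x s t :: nat
  assumes "even x" "even s"
  shows "(x * s + t) mod 4 = t mod 4"
proof -
  have "4 dvd x * s"
    using mult_dvd_mono [OF assms] by simp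
  then show ?thesis
    by (auto elim!: dvdE)
qed

text \<open>Modulo 4 the summand \<open>x * (y + z)\<close> disappears, leaving \<open>y * z\<close>
  congruent to 3, so \<open>y\<close> and \<open>z\<close> lie in different odd classes. This makes
  \<open>(z - y) div 2\<close> odd in the bijection below.\<close>

lemma diff_mod_4_eq_2:
  fixes x y z :: nat
  assumes "even x" "odd y" "odd z" "y < z" "(x * y + y * z + z * x) mod 8 = 3"
  shows "(z - y) mod 4 = 2"
proof -
  have e: "x * y + y * z + z * x = x * (y + z) + y * z"
    by (simp add: algebra_simps)
  have "y * z mod 4 = 3"
    using mod_4_add_even_mult [of x "y + z" "y * z"] mod_8_eq_3_imp_mod_4 [OF assms(5)] assms(1-3)
    unfolding e by simp
  then have "y mod 4 \<noteq> z mod 4"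
    using mod_4_mult_odd [OF assms(2,3)] by auto
  moreover obtain e where e: "z = y + e"
    using assms(4) less_imp_add_positive by blast
  moreover have "even e" using e assms(2,3) by simp
  ultimately have "e mod 4 \<noteq> 0" "even e"
    by (metis add_0_right mod_add_right_eq)+
  then show ?thesis
    unfolding e by simp presburger
qed

text \<open>Inverse direction of that bijection: with odd \<open>k\<close> the value would be 7
  modulo 8. This is where modulus 8 rather than 4 matters.\<close>

lemma even_if_mod_8_eq_3:
  fixes p q k :: nat
  assumes "odd p" "odd q" "(p * q + q * (p + 2 * k) + (p + 2 * k) * p) mod 8 = 3"
  shows "even k"
proof (rule ccontr)
  assume "odd k"
  with assms(1,2) obtain a b c where abc: "p = 2 * a + 1" "q = 2 * b + 1" "k = 2 * c + 1"
    by (meson oddE)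
  \<comment> \<open>The only coefficient not divisible by 8 belongs to \<open>a * (a + 1)\<close>, a
    product of consecutive numbers.\<close>
  have "even (a * (a + 1))" by simp
  then obtain d where d: "a * (a + 1) = 2 * d" by (rule evenE)
  have "p * q + q * (p + 2 * k) + (p + 2 * k) * p
      = 4 * (a * (a + 1)) + 8 * (a * b + a * c + b * c + a + b + c) + 7"
    unfolding abc by (simp add: algebra_simps)
  also have "\<dots> = 7 + 8 * (d + (a * b + a * c + b * c + a + b + c))"
    unfolding d by simp
  finally have "(p * q + q * (p + 2 * k) + (p + 2 * k) * p) mod 8 = 7"
    by (simp only: mod_mult_self2) simp
  then show False using assms(3) by simp
qed

text \<open>Triples (even, odd, odd) with \<open>y < z\<close> correspond to all-odd triples with
  \<open>p < r\<close> through \<open>p = y\<close>, \<open>q = (z - y) / 2\<close>,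
  \<open>r = 2 x + y\<close>, which preserves the value; the residue 3 modulo 8 makes the parities
  match in both directions. The three positions of the even entry reflect the factor 3 between
  weighted class numbers of discriminants \<open>-4 n\<close> and \<open>-n\<close>.\<close>

lemma mixed_parity_eq_same_parity:
  assumes n: "n mod 8 = 3"
  shows "mixed_parity n = same_parity n"
proof -
  have n0: "n > 0" using n by (cases "n = 0") auto
  let ?o = "\<lambda>x y z. odd x \<and> odd y \<and> odd (z :: nat)"
  have l: "wcount n (\<lambda>x y z. x > 0 \<and> even x \<and> odd y \<and> odd z \<and> y < z) = wcount n (\<lambda>p q r. ?o p q r \<and> p < r)"
    unfolding wcount_def
  proof (rule sum.reindex_bij_witness [of _ "\<lambda>(p, q, r). ((r - p) div 2, p, 2 * q + p)"
        "\<lambda>(x, y, z). (y, (z - y) div 2, 2 * x + y)"])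
    fix t assume t: "t \<in> triples n (\<lambda>x y z. x > 0 \<and> even x \<and> odd y \<and> odd z \<and> y < z)"
    obtain x y z where "t = (x, y, z)" by (cases t)
    with t have h: "t = (x, y, z)" "x > 0" "even x" "odd y" "odd z" "y < z" "x * y + y * z + z * x = n"
      by (auto simp: triples_def)
    then have "(z - y) mod 4 = 2"
      using n by (intro diff_mod_4_eq_2 [of x]) simp_all
    then obtain d where d: "z - y = 2 * d" "odd d"
      using mod_4_eq_2 by blast
    then have z: "z = y + 2 * d" using h by simp
    show "(case (case t of (x, y, z) \<Rightarrow> (y, (z - y) div 2, 2 * x + y)) of (p, q, r) \<Rightarrow> ((r - p) div 2, p, 2 * q + p)) = t"
      by (simp add: h(1) z)
    show "(case t of (x, y, z) \<Rightarrow> (y, (z - y) div 2, 2 * x + y)) \<in> triples n (\<lambda>p q r. ?o p q r \<and> p < r)"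
      using h d by (auto simp: triples_def z algebra_simps)
    show "(case (case t of (x, y, z) \<Rightarrow> (y, (z - y) div 2, 2 * x + y)) of (x, y, z) \<Rightarrow> wt x y z) = (case t of (x, y, z) \<Rightarrow> wt x y z)"
      using h d by (auto simp: z wt_def odd_pos)
  next
    fix t assume t: "t \<in> triples n (\<lambda>p q r. ?o p q r \<and> p < r)"
    obtain p q r where "t = (p, q, r)" by (cases t)
    with t have h: "t = (p, q, r)" "odd p" "odd q" "odd r" "p < r" "p * q + q * r + r * p = n"
      by (auto simp: triples_def)
    then have "even (r - p)" by simp
    then obtain k where "r - p = 2 * k" by (rule evenE)
    then have k: "r = p + 2 * k" "k > 0" using h(5) by auto
    then have "even k" using even_if_mod_8_eq_3 [of p q k] h n by simp
    then show "(case t of (p, q, r) \<Rightarrow> ((r - p) div 2, p, 2 * q + p)) \<in> triples n (\<lambda>x y z. x > 0 \<and> even x \<and> odd y \<and> odd z \<and> y < z)"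
      using h k by (auto simp: triples_def algebra_simps odd_pos)
    show "(case (case t of (p, q, r) \<Rightarrow> ((r - p) div 2, p, 2 * q + p)) of (x, y, z) \<Rightarrow> (y, (z - y) div 2, 2 * x + y)) = t"
      using h k by simp
  qed
  \<comment> \<open>The boundary \<open>x = 0\<close>, of weight 1, goes to the diagonal
    \<open>p = r\<close>, of weight 2.\<close>
  have e: "2 * wcount n (\<lambda>x y z. x = 0 \<and> odd y \<and> odd z \<and> y < z) = wcount n (\<lambda>p q r. ?o p q r \<and> p = r)"
    unfolding wcount_def sum_distrib_left
  proof (rule sum.reindex_bij_witness [of _ "\<lambda>(p, q, r). (0, p, 2 * q + p)" "\<lambda>(x, y, z). (y, (z - y) div 2, y)"])
    fix t assume t: "t \<in> triples n (\<lambda>x y z. x = 0 \<and> odd y \<and> odd z \<and> y < z)"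
    obtain x y z where "t = (x, y, z)" by (cases t)
    with t have h: "t = (0, y, z)" "odd y" "odd z" "y < z" "y * z = n"
      by (auto simp: triples_def)
    then have "(z - y) mod 4 = 2"
      using n by (intro diff_mod_4_eq_2 [of 0]) simp_all
    then obtain d where d: "z - y = 2 * d" "odd d"
      using mod_4_eq_2 by blast
    then have z: "z = y + 2 * d" using h by simp
    show "(case (case t of (x, y, z) \<Rightarrow> (y, (z - y) div 2, y)) of (p, q, r) \<Rightarrow> (0, p, 2 * q + p)) = t"
      by (simp add: h(1) z)
    show "(case t of (x, y, z) \<Rightarrow> (y, (z - y) div 2, y)) \<in> triples n (\<lambda>p q r. ?o p q r \<and> p = r)"
      using h d by (auto simp: triples_def z algebra_simps)
    show "(case (case t of (x, y, z) \<Rightarrow> (y, (z - y) div 2, y)) of (x, y, z) \<Rightarrow> wt x y z) = 2 * (case t of (x, y, z) \<Rightarrow> wt x y z)"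
      using h d by (auto simp: z wt_def odd_pos)
  next
    fix t assume t: "t \<in> triples n (\<lambda>p q r. ?o p q r \<and> p = r)"
    then show "(case (case t of (p, q, r) \<Rightarrow> (0, p, 2 * q + p)) of (x, y, z) \<Rightarrow> (y, (z - y) div 2, y)) = t"
      by (auto simp: triples_def)
    show "(case t of (p, q, r) \<Rightarrow> (0, p, 2 * q + p)) \<in> triples n (\<lambda>x y z. x = 0 \<and> odd y \<and> odd z \<and> y < z)"
      using t by (auto simp: triples_def algebra_simps odd_pos)
  qed
  have "odd n" using n by presburger
  then have "mixed_parity n = wcount n (\<lambda>x y z. even x \<and> odd y \<and> odd z)"
    unfolding mixed_parity_def by (intro wcount_cong) auto
  also have "\<dots> = wcount n (\<lambda>x y z. even x \<and> odd y \<and> odd z \<and> (y < z \<or> z < y))"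
  proof (rule wcount_cong)
    fix x y z assume "x * y + y * z + z * x = n"
    \<comment> \<open>For \<open>y = z\<close> the value would be \<open>y * y\<close> modulo 4,
      that is 1, instead of 3.\<close>
    then have "y \<noteq> z" if "even x" "odd y"
    proof -
      have "(x * (y + y) + y * y) mod 4 = 1"
        using that by (subst mod_4_add_even_mult) (simp_all add: mod_4_mult_odd)
      then show ?thesis
        using \<open>x * y + y * z + z * x = n\<close> mod_8_eq_3_imp_mod_4 [OF n]
        by (auto simp: distrib_left mult.commute add_ac)
    qed
    then show "(even x \<and> odd y \<and> odd z) = (even x \<and> odd y \<and> odd z \<and> (y < z \<or> z < y))"
      by auto
  qed
  also have "\<dots> = wcount n (\<lambda>x y z. even x \<and> odd y \<and> odd z \<and> y < z) + wcount n (\<lambda>x y z. even x \<and> odd y \<and> odd z \<and> z < y)"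
    by (rule wcount_disj [OF n0]) auto
  also have "wcount n (\<lambda>x y z. even x \<and> odd y \<and> odd z \<and> z < y) = wcount n (\<lambda>x y z. even x \<and> odd y \<and> odd z \<and> y < z)"
    by (subst wcount_swap23) (rule wcount_cong, auto)
  also have "wcount n (\<lambda>x y z. even x \<and> odd y \<and> odd z \<and> y < z)
      = wcount n (\<lambda>x y z. x > 0 \<and> even x \<and> odd y \<and> odd z \<and> y < z) + wcount n (\<lambda>x y z. x = 0 \<and> odd y \<and> odd z \<and> y < z)"
    by (rule wcount_disj [OF n0]) auto
  finally have 1: "mixed_parity n = 2 * wcount n (\<lambda>p q r. ?o p q r \<and> p < r) + wcount n (\<lambda>p q r. ?o p q r \<and> p = r)"
    using e unfolding l by simp
  have "same_parity n = wcount n ?o"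
    unfolding same_parity_def using \<open>odd n\<close> by (intro wcount_cong) auto
  also have "\<dots> = wcount n (\<lambda>p q r. ?o p q r \<and> (p < r \<or> r < p)) + wcount n (\<lambda>p q r. ?o p q r \<and> p = r)"
    by (rule wcount_disj [OF n0]) auto
  also have "wcount n (\<lambda>p q r. ?o p q r \<and> (p < r \<or> r < p)) = wcount n (\<lambda>p q r. ?o p q r \<and> p < r) + wcount n (\<lambda>p q r. ?o p q r \<and> r < p)"
    by (rule wcount_disj [OF n0]) auto
  also have "wcount n (\<lambda>p q r. ?o p q r \<and> r < p) = wcount n (\<lambda>p q r. ?o p q r \<and> p < r)"
    by (subst wcount_swap13) (rule wcount_cong, auto)
  finally show ?thesis using 1 by simp
qed

text \<open>The recurrence is triangular with eigenvalues 1 and 2; \<open>3 * (2 ^ a - 1)\<close> is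
  3 times the geometric sum of the powers of 2 below \<open>2 ^ a\<close>.\<close>

lemma parity_counts_power_4:
  assumes "n > 0"
  shows "mixed_parity (4 ^ a * n) = 2 ^ a * mixed_parity n"
    and "same_parity (4 ^ a * n) = same_parity n + 3 * (2 ^ a - 1) * mixed_parity n"
proof -
  show m: "mixed_parity (4 ^ a * n) = 2 ^ a * mixed_parity n" for a
    using assms by (induction a) (simp_all add: mixed_parity_mult_4 mult.assoc)
  show "same_parity (4 ^ a * n) = same_parity n + 3 * (2 ^ a - 1) * mixed_parity n"
  proof (induction a)
    case (Suc a)
    have "same_parity (4 ^ Suc a * n) = same_parity (4 ^ a * n) + 3 * mixed_parity (4 ^ a * n)"
      using same_parity_mult_4 [of "4 ^ a * n"] assms by (simp add: mult.assoc)
    then show ?case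
      unfolding Suc m by (simp add: algebra_simps)
  qed simp
qed

lemma count_power_4_mod_4:
  assumes "n mod 4 = 1 \<or> n mod 4 = 2"
  shows "wcount (4 ^ a * n) (\<lambda>x y z. even x \<longleftrightarrow> even y) = (2 ^ (a + 2) - 3) * mixed_parity n"
proof -
  have "n > 0" using assms by (cases "n = 0") auto
  then have "wcount (4 ^ a * n) (\<lambda>x y z. even x \<longleftrightarrow> even y) = same_parity (4 ^ a * n) + mixed_parity (4 ^ a * n)"
    by (intro wcount_parity_12) simp
  then show ?thesis
    unfolding parity_counts_power_4 [OF \<open>n > 0\<close>] same_parity_eq_0 [OF assms]
    by (simp add: algebra_simps)
qed

lemma count_power_4_mod_8:
  assumes "n mod 8 = 3"
  shows "wcount (4 ^ a * n) (\<lambda>x y z. even x \<longleftrightarrow> even y) = (2 ^ (a + 1) - 1) * (2 * same_parity n)"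
proof -
  have "n > 0" using assms by (cases "n = 0") auto
  then have "wcount (4 ^ a * n) (\<lambda>x y z. even x \<longleftrightarrow> even y) = same_parity (4 ^ a * n) + mixed_parity (4 ^ a * n)"
    by (intro wcount_parity_12) simp
  then show ?thesis
    unfolding parity_counts_power_4 [OF \<open>n > 0\<close>] mixed_parity_eq_same_parity [OF assms]
    by (simp add: algebra_simps)
qed

section \<open>The rank parity series as a Lambert series divided by a theta series\<close>

abbreviation q :: "rat fps" where "q \<equiv> fps_X"

text \<open>Congruence modulo \<open>q ^ n\<close>, the finite substitute for convergence of
  infinite sums and products. It determines exactly the coefficients of index below
  \<open>n\<close>.\<close>

definition agree :: "nat \<Rightarrow> rat fps \<Rightarrow> rat fps \<Rightarrow> bool" where
  "agree n a b \<longleftrightarrow> q ^ n dvd a - b"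

lemma agree_refl [simp]: "agree n a a"
  by (simp add: agree_def)

lemma agree_sym: "agree n a b \<Longrightarrow> agree n b a"
  unfolding agree_def by (subst dvd_minus_iff [symmetric]) simp

lemma agree_trans [trans]: "agree n a b \<Longrightarrow> agree n b c \<Longrightarrow> agree n a c"
  unfolding agree_def by (drule (1) dvd_add) simp

lemma agree_add: "agree n a b \<Longrightarrow> agree n c d \<Longrightarrow> agree n (a + c) (b + d)"
  unfolding agree_def by (drule (1) dvd_add) (simp add: algebra_simps)

lemma agree_diff: "agree n a b \<Longrightarrow> agree n c d \<Longrightarrow> agree n (a - c) (b - d)"
  unfolding agree_def by (drule (1) dvd_diff) (simp add: algebra_simps)

lemma agree_mult_left: "agree n a b \<Longrightarrow> agree n (c * a) (c * b)"
  unfolding agree_def by (drule dvd_mult [of _ _ c]) (simp add: algebra_simps)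

lemma agree_mult: "agree n a b \<Longrightarrow> agree n c d \<Longrightarrow> agree n (a * c) (b * d)"
  using agree_mult_left [of n c d a] agree_mult_left [of n a b d]
  by (simp add: mult.commute agree_trans)

lemma agree_sum: "(\<And>i. i \<in> S \<Longrightarrow> agree n (f i) (g i)) \<Longrightarrow> agree n (sum f S) (sum g S)"
  by (induction S rule: infinite_finite_induct) (auto intro: agree_add)

lemma agree_nth: "agree n a b \<Longrightarrow> i < n \<Longrightarrow> fps_nth a i = fps_nth b i"
  unfolding agree_def dvd_def
  by (metis eq_iff_diff_eq_0 fps_X_power_mult_nth fps_sub_nth)

lemma agree_power_0: "n \<le> k \<Longrightarrow> agree n (q ^ k) 0"
  by (simp add: agree_def le_imp_power_dvd)

lemma agree_power_mult_0: "n \<le> k \<Longrightarrow> agree n (q ^ k * a) 0"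
  by (simp add: agree_def le_imp_power_dvd dvd_mult2)

lemma agree_cancel_left:
  assumes "agree n (c * a) (c * b)" and "fps_nth c 0 \<noteq> 0"
  shows "agree n a b"
proof -
  have "agree n (inverse c * (c * a)) (inverse c * (c * b))"
    by (intro agree_mult_left assms)
  then show ?thesis
    using assms(2) by (simp add: mult.assoc [symmetric] inverse_mult_eq_1)
qed

lemma agree_sum_mono_neutral:
  assumes "finite S" "finite T"
    and "\<And>i. i \<in> S - T \<Longrightarrow> agree n (f i) 0" and "\<And>i. i \<in> T - S \<Longrightarrow> agree n (f i) 0"
  shows "agree n (sum f S) (sum f T)"
proof -
  have "agree n (sum f S) (sum f (S \<inter> T))" if "finite S" "\<And>i. i \<in> S - T \<Longrightarrow> agree n (f i) 0" for S T
  proof -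
    have "agree n (sum f (S \<inter> T) + sum f (S - T)) (sum f (S \<inter> T) + sum (\<lambda>_. 0) (S - T))"
      by (intro agree_add agree_sum that) auto
    then show ?thesis
      using sum.Int_Diff [OF that(1), of f T] by simp
  qed
  from this [of S T] this [of T S] show ?thesis
    using assms by (auto simp: Int_commute intro: agree_trans agree_sym)
qed

section \<open>The q-Pochhammer symbols \<open>(q; q)_n\<close>, \<open>(-q; q)_n\<close> and finite
  Bailey sums\<close>

definition poch :: "nat \<Rightarrow> rat fps" where
  "poch n = (\<Prod>i=1..n. 1 - q ^ i)"

definition npoch :: "nat \<Rightarrow> rat fps" where
  "npoch n = (\<Prod>i=1..n. 1 + q ^ i)"

lemma poch_0 [simp]: "poch 0 = 1" and npoch_0 [simp]: "npoch 0 = 1"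
  by (simp_all add: poch_def npoch_def)

lemma poch_Suc: "poch (Suc n) = poch n * (1 - q ^ Suc n)"
  and npoch_Suc: "npoch (Suc n) = npoch n * (1 + q ^ Suc n)"
  by (simp_all add: poch_def npoch_def)

lemma nth_0_one_plus_power [simp]: "k > 0 \<Longrightarrow> fps_nth (1 + q ^ k) 0 = 1"
  and nth_0_one_minus_power [simp]: "k > 0 \<Longrightarrow> fps_nth (1 - q ^ k) 0 = 1"
  by simp_all

lemma poch_nth_0 [simp]: "fps_nth (poch n) 0 = 1"
  by (induction n) (simp_all add: poch_Suc)

lemma npoch_nth_0 [simp]: "fps_nth (npoch n) 0 = 1"
  by (induction n) (simp_all add: npoch_Suc)

lemma inverse_poch: "poch n * inverse (poch n) = 1"
  and inverse_npoch: "npoch n * inverse (npoch n) = 1"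
  by (simp_all add: inverse_mult_eq_1')

lemma inverse_one_plus_power: "k > 0 \<Longrightarrow> (1 + q ^ k) * inverse (1 + q ^ k) = 1"
  and inverse_one_minus_power: "k > 0 \<Longrightarrow> (1 - q ^ k) * inverse (1 - q ^ k) = 1"
  by (simp_all add: inverse_mult_eq_1')

lemma inverse_mult_right:
  fixes a b :: "rat fps"
  assumes "b * inverse b = 1"
  shows "inverse a = b * inverse (a * b)"
proof -
  have "b * inverse (a * b) = inverse a * (b * inverse b)"
    unfolding fps_inverse_mult by (simp only: mult_ac)
  then show ?thesis using assms by simp
qed

lemma inverse_poch_Suc: "inverse (poch n) = (1 - q ^ Suc n) * inverse (poch (Suc n))"
  unfolding poch_Suc by (intro inverse_mult_right inverse_one_minus_power) simp

lemma inverse_npoch_Suc: "inverse (npoch n) = (1 + q ^ Suc n) * inverse (npoch (Suc n))"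
  unfolding npoch_Suc by (intro inverse_mult_right inverse_one_plus_power) simp

text \<open>The kernel of Bailey's lemma with parameter \<open>a = 1\<close>. Truncated subtraction
  prevents it from vanishing for \<open>r > n\<close>, so sums must stop at
  \<open>n\<close>.\<close>

definition bkernel :: "nat \<Rightarrow> nat \<Rightarrow> rat fps" where
  "bkernel n r = inverse (poch (n - r)) * inverse (poch (n + r))"

lemma bkernel_pred:
  assumes "r \<le> n"
  shows "bkernel n r = (1 - q ^ (Suc n - r)) * (1 - q ^ (Suc n + r)) * bkernel (Suc n) r"
  using assms inverse_poch_Suc [of "n - r"] inverse_poch_Suc [of "n + r"]
  by (simp add: bkernel_def Suc_diff_le)

text \<open>The range may grow to \<open>Suc n\<close>, since there the new factor is
  \<open>1 - q ^ 0 = 0\<close>; sums at levels \<open>n\<close> and \<open>Suc n\<close> thus become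
  comparable term by term.\<close>

lemma sum_bkernel_pred:
  "(\<Sum>r=1..n. f r * bkernel n r) =
     (\<Sum>r=1..Suc n. f r * ((1 - q ^ (Suc n - r)) * (1 - q ^ (Suc n + r)) * bkernel (Suc n) r))"
proof -
  have "(\<Sum>r=1..n. f r * bkernel n r)
     = (\<Sum>r=1..n. f r * ((1 - q ^ (Suc n - r)) * (1 - q ^ (Suc n + r)) * bkernel (Suc n) r))"
    by (intro sum.cong refl arg_cong [where f = "(*) (f _)"] bkernel_pred) simp
  then show ?thesis by simp
qed

lemma bkernel_pred_0: "bkernel n 0 = (1 - q ^ Suc n) * (1 - q ^ Suc n) * bkernel (Suc n) 0"
  using bkernel_pred [of 0 n] by simp

text \<open>Bailey transform of the coefficients \<open>(-1)^r q^(r^2)\<close> over all integers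
  \<open>r\<close>, with \<open>r\<close> and \<open>-r\<close> folded together.\<close>

definition theta_kernel :: "nat \<Rightarrow> rat fps" where
  "theta_kernel n = bkernel n 0 + 2 * (\<Sum>r=1..n. (- 1) ^ r * q ^ (r\<^sup>2) * bkernel n r)"

lemma diff_combine_sums:
  fixes a b c x :: "'a :: comm_ring"
  shows "a * (x + c * sum f S) - (b * x + c * sum h S) = (a - b) * x + c * (\<Sum>r\<in>S. a * f r - h r)"
  by (simp add: sum_subtractf sum_distrib_left algebra_simps)

text \<open>The coefficient difference is
  \<open>q^(m+r) (1 - q^(m-r)) + q^(m-r) (1 - q^(m+r))\<close>. Its two halves \<open>a r\<close>
  and \<open>b r\<close> satisfy \<open>b (r + 1) = - a r\<close>, so the sum telescopes to
  \<open>a m\<close>, which vanishes.\<close>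

lemma theta_kernel_Suc: "theta_kernel n = (1 - q ^ (2 * Suc n)) * theta_kernel (Suc n)"
proof -
  define m where "m = Suc n"
  define g where "g = bkernel m"
  define a where "a r = (- 1) ^ r * q ^ (r\<^sup>2 + m + r) * (1 - q ^ (m - r)) * g r" for r
  define b where "b r = (- 1) ^ r * q ^ (r\<^sup>2 - r + m) * (1 - q ^ (m + r)) * g r" for r
  have ba: "b (Suc r) = - a r" if "r < m" for r
  proof -
    have "m - r = Suc (m - Suc r)" using that by simp
    then have e1: "inverse (poch (m - Suc r)) = (1 - q ^ (m - r)) * inverse (poch (m - r))"
      using inverse_poch_Suc [of "m - Suc r"] by metis
    have e2: "inverse (poch (m + r)) = (1 - q ^ (m + Suc r)) * inverse (poch (m + Suc r))"
      using inverse_poch_Suc [of "m + r"] by (metis add_Suc_right)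
    have "g (Suc r) * (1 - q ^ (m + Suc r)) = g r * (1 - q ^ (m - r))"
      unfolding g_def bkernel_def e1 e2 by (simp only: mult_ac)
    moreover have "(Suc r)\<^sup>2 - Suc r + m = r\<^sup>2 + m + r"
      by (simp add: power2_eq_square)
    moreover have "b (Suc r) = (- 1) ^ Suc r * q ^ ((Suc r)\<^sup>2 - Suc r + m) * (g (Suc r) * (1 - q ^ (m + Suc r)))"
      unfolding b_def by (simp only: mult_ac)
    ultimately have "b (Suc r) = (- 1) ^ Suc r * q ^ (r\<^sup>2 + m + r) * (g r * (1 - q ^ (m - r)))"
      by metis
    then show ?thesis
      by (simp add: a_def mult_ac)
  qed
  have step: "(1 - q ^ (2 * m)) * ((- 1) ^ r * q ^ (r\<^sup>2) * g r)
      - (- 1) ^ r * q ^ (r\<^sup>2) * ((1 - q ^ (m - r)) * (1 - q ^ (m + r)) * g r) = a r + b r"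
    if "r \<le> m" for r
  proof -
    have e: "q ^ (2 * m) = q ^ (m - r) * q ^ (m + r)"
      using that by (simp add: power_add [symmetric])
    have "r \<le> r\<^sup>2" by (simp add: power2_eq_square)
    then have f: "q ^ (r\<^sup>2 - r + m) = q ^ (r\<^sup>2) * q ^ (m - r)"
      using that by (simp add: power_add [symmetric])
    have h: "q ^ (r\<^sup>2 + m + r) = q ^ (r\<^sup>2) * q ^ (m + r)"
      by (simp add: power_add)
    show ?thesis unfolding a_def b_def e f h by algebra
  qed
  have "(1 - q ^ (2 * m)) * theta_kernel m - theta_kernel n
      = ((1 - q ^ (2 * m)) - (1 - q ^ m) * (1 - q ^ m)) * g 0
        + 2 * (\<Sum>r=1..m. (1 - q ^ (2 * m)) * ((- 1) ^ r * q ^ (r\<^sup>2) * g r)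
      - (- 1) ^ r * q ^ (r\<^sup>2) * ((1 - q ^ (m - r)) * (1 - q ^ (m + r)) * g r))"
    unfolding theta_kernel_def sum_bkernel_pred bkernel_pred_0 [of n] m_def [symmetric] g_def [symmetric]
    by (rule diff_combine_sums)
  \<comment> \<open>The unfolded term \<open>r = 0\<close> supplies exactly the
    \<open>2 * a 0\<close> missing from the telescoping sum.\<close>
  also have "((1 - q ^ (2 * m)) - (1 - q ^ m) * (1 - q ^ m)) * g 0 = 2 * a 0"
    unfolding mult_2 [of m] power_add by (simp add: a_def algebra_simps)
  also have "(\<Sum>r=1..m. (1 - q ^ (2 * m)) * ((- 1) ^ r * q ^ (r\<^sup>2) * g r)
      - (- 1) ^ r * q ^ (r\<^sup>2) * ((1 - q ^ (m - r)) * (1 - q ^ (m + r)) * g r)) = (\<Sum>r=1..m. a r + b r)"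
    by (intro sum.cong refl step) auto
  also have "(\<Sum>r=1..m. a r + b r) = (\<Sum>r=1..m. a r) + (\<Sum>r<m. b (Suc r))"
    by (simp add: sum.distrib sum.atLeast1_atMost_eq)
  also have "\<dots> = (\<Sum>r=1..m. a r) - (\<Sum>r<m. a r)"
    using ba by (simp add: sum_negf)
  also have "(\<Sum>r=1..m. a r) = (\<Sum>r<m. a r) + a m - a 0"
    by (simp add: sum.atLeast1_atMost_eq sum.lessThan_Suc_shift [symmetric]
        flip: sum.lessThan_Suc) (metis add_diff_cancel_left' sum.lessThan_Suc_shift)
  finally have "(1 - q ^ (2 * m)) * theta_kernel m - theta_kernel n = 2 * a m"
    by simp
  also have "a m = 0" by (simp add: a_def)
  finally show ?thesis by (simp add: m_def)
qed

lemma theta_kernel_eq: "theta_kernel n = inverse (poch n) * inverse (npoch n)"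
proof (induction n)
  case 0
  show ?case by (simp add: theta_kernel_def bkernel_def)
next
  case (Suc n)
  have "q ^ (2 * Suc n) = q ^ Suc n * q ^ Suc n"
    by (metis mult_2 power_add)
  moreover have "1 - x * x = (1 - x) * (1 + x)" for x :: "rat fps"
    by algebra
  ultimately have e: "1 - q ^ (2 * Suc n) = (1 - q ^ Suc n) * (1 + q ^ Suc n)"
    by metis
  have "(1 - q ^ (2 * Suc n)) * theta_kernel (Suc n) = inverse (poch n) * inverse (npoch n)"
    using theta_kernel_Suc [of n] Suc by metis
  also have "\<dots> = (1 - q ^ (2 * Suc n)) * (inverse (poch (Suc n)) * inverse (npoch (Suc n)))"
    unfolding inverse_poch_Suc [of n] inverse_npoch_Suc [of n] e by (simp only: mult_ac)
  finally have "(1 - q ^ (2 * Suc n)) * theta_kernel (Suc n)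
     = (1 - q ^ (2 * Suc n)) * (inverse (poch (Suc n)) * inverse (npoch (Suc n)))" .
  then show ?case
    using nth_0_one_minus_power [of "2 * Suc n"]
    by (metis mult_left_cancel fps_zero_nth zero_neq_one nat_0_less_mult_iff zero_less_Suc pos2)
qed

text \<open>Bailey transform of \<open>4 (-1)^r q^(r^2+r) / (1 + q^r)^2\<close>, which is invariant
  under \<open>r\<close> to \<open>-r\<close> and equals 1 at \<open>r = 0\<close>; folding turns 4
  into 8.\<close>

definition lambert_kernel :: "nat \<Rightarrow> rat fps" where
  "lambert_kernel n = bkernel n 0
     + 8 * (\<Sum>r=1..n. (- 1) ^ r * q ^ (r\<^sup>2 + r) * (inverse (1 + q ^ r))\<^sup>2 * bkernel n r)"

text \<open>The identity \<open>(1 + q^m)^2 - (1 - q^(m-r)) (1 - q^(m+r)) = q^(m-r) (1 +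
  q^r)^2\<close> cancels the denominators, so a theta kernel with known closed form remains.\<close>

lemma lambert_kernel_Suc:
  "(1 + q ^ Suc n)\<^sup>2 * lambert_kernel (Suc n) = lambert_kernel n + 4 * q ^ Suc n * theta_kernel (Suc n)"
proof -
  define m where "m = Suc n"
  define g where "g = bkernel m"
  have step: "(1 + q ^ m)\<^sup>2 * ((- 1) ^ r * q ^ (r\<^sup>2 + r) * (inverse (1 + q ^ r))\<^sup>2 * g r)
      - (- 1) ^ r * q ^ (r\<^sup>2 + r) * (inverse (1 + q ^ r))\<^sup>2 * ((1 - q ^ (m - r)) * (1 - q ^ (m + r)) * g r)
      = (- 1) ^ r * q ^ (r\<^sup>2) * q ^ m * g r"
    if "1 \<le> r" "r \<le> m" for r
  proof -
    have e: "q ^ m = q ^ (m - r) * q ^ r" "q ^ (m + r) = q ^ (m - r) * q ^ r * q ^ r"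
      using that by (simp_all add: power_add [symmetric])
    have f: "(1 + q ^ r) * inverse (1 + q ^ r) = 1"
      using inverse_one_plus_power that by simp
    \<comment> \<open>Here \<open>x\<close> stands for \<open>q ^ r\<close>, \<open>y\<close> for
      \<open>q ^ (m - r)\<close> and \<open>i\<close> for the inverse of
      \<open>1 + x\<close>.\<close>
    have "(1 + y * x)\<^sup>2 * (s * (t * x) * i\<^sup>2 * h) - s * (t * x) * i\<^sup>2 * ((1 - y) * (1 - y * x * x) * h)
        = s * t * (y * x) * h" if "(1 + x) * i = 1" for x y s t i h :: "rat fps"
      using that by algebra
    from this [OF f] show ?thesis unfolding e power_add .
  qed
  have "(1 + q ^ m)\<^sup>2 * lambert_kernel m - lambert_kernel n
      = ((1 + q ^ m)\<^sup>2 - (1 - q ^ m) * (1 - q ^ m)) * g 0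
       + 8 * (\<Sum>r=1..m. (1 + q ^ m)\<^sup>2 * ((- 1) ^ r * q ^ (r\<^sup>2 + r) * (inverse (1 + q ^ r))\<^sup>2 * g r)
      - (- 1) ^ r * q ^ (r\<^sup>2 + r) * (inverse (1 + q ^ r))\<^sup>2 * ((1 - q ^ (m - r)) * (1 - q ^ (m + r)) * g r))"
    unfolding lambert_kernel_def sum_bkernel_pred bkernel_pred_0 [of n] m_def [symmetric] g_def [symmetric]
    by (rule diff_combine_sums)
  also have "(1 + q ^ m)\<^sup>2 - (1 - q ^ m) * (1 - q ^ m) = 4 * q ^ m"
    by algebra
  also have "(\<Sum>r=1..m. (1 + q ^ m)\<^sup>2 * ((- 1) ^ r * q ^ (r\<^sup>2 + r) * (inverse (1 + q ^ r))\<^sup>2 * g r)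
      - (- 1) ^ r * q ^ (r\<^sup>2 + r) * (inverse (1 + q ^ r))\<^sup>2 * ((1 - q ^ (m - r)) * (1 - q ^ (m + r)) * g r))
      = (\<Sum>r=1..m. (- 1) ^ r * q ^ (r\<^sup>2) * q ^ m * g r)"
    by (intro sum.cong refl step) auto
  finally show ?thesis
    by (simp add: theta_kernel_def m_def [symmetric] g_def [symmetric] sum_distrib_left
        algebra_simps)
qed


section \<open>The q-binomial series and the alternating sum over the largest part\<close>

definition gauss_coeff :: "nat \<Rightarrow> rat fps" where
  "gauss_coeff k = (if k = 0 then 1 else 2 * npoch (k - 1) * inverse (poch k))"

text \<open>The product \<open>u\<close> of the overview; its limit \<open>(q; q) / (-q; q)\<close>
  is Gauss's product for theta.\<close>

definition eta_quot :: "nat \<Rightarrow> rat fps" where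
  "eta_quot n = poch n * inverse (npoch n)"

lemma eta_quot_0 [simp]: "eta_quot 0 = 1"
  by (simp add: eta_quot_def)

lemma eta_quot_Suc: "(1 + q ^ Suc n) * eta_quot (Suc n) = (1 - q ^ Suc n) * eta_quot n"
  unfolding eta_quot_def inverse_npoch_Suc [of n] poch_Suc by (simp only: mult_ac)

lemma gauss_coeff_Suc: "(1 - q ^ Suc k) * gauss_coeff (Suc k) = (1 + q ^ k) * gauss_coeff k"
proof (cases k)
  case 0
  then show ?thesis
    using inverse_one_minus_power [of 1] by (simp add: gauss_coeff_def poch_def mult.left_commute)
next
  case (Suc l)
  have n: "npoch k = npoch l * (1 + q ^ k)"
    by (simp only: Suc npoch_Suc)
  have "gauss_coeff k = 2 * npoch l * inverse (poch k)" "gauss_coeff (Suc k) = 2 * npoch k * inverse (poch (Suc k))"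
    by (simp_all add: gauss_coeff_def Suc)
  then show ?thesis
    unfolding n inverse_poch_Suc [of k] by (simp only: mult_ac)
qed

text \<open>Multiplying by \<open>(npoch n)\<^sup>2\<close> turns the recurrence into pure
  summation; step \<open>m\<close> adds
  \<open>4 q^m npoch (m-1) / (poch m (1 + q^m))\<close>.\<close>

lemma lambert_kernel_eq:
  "(npoch n)\<^sup>2 * lambert_kernel n = 1 + (\<Sum>k=1..n. 2 * gauss_coeff k * q ^ k * inverse (1 + q ^ k))"
proof (induction n)
  case 0
  show ?case by (simp add: lambert_kernel_def bkernel_def)
next
  case (Suc n)
  define j where "j = inverse (1 + q ^ Suc n)"
  have j: "(1 + q ^ Suc n) * j = 1"
    unfolding j_def by (rule inverse_one_plus_power) simp
  have "(npoch (Suc n))\<^sup>2 * lambert_kernel (Suc n)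
      = (npoch n)\<^sup>2 * ((1 + q ^ Suc n)\<^sup>2 * lambert_kernel (Suc n))"
    unfolding npoch_Suc by (simp only: power_mult_distrib mult_ac)
  also have "\<dots> = (npoch n)\<^sup>2 * lambert_kernel n
      + 4 * q ^ Suc n * npoch n * inverse (poch (Suc n)) * (npoch n * inverse (npoch (Suc n)))"
    unfolding lambert_kernel_Suc theta_kernel_eq by (simp only: distrib_left power2_eq_square mult_ac)
  also have "npoch n * inverse (npoch (Suc n)) = j"
    using inverse_npoch [of n] unfolding npoch_Suc fps_inverse_mult j_def
    by (simp only: mult.assoc [symmetric]) simp
  also have "4 * q ^ Suc n * npoch n * inverse (poch (Suc n)) * j = 2 * gauss_coeff (Suc n) * q ^ Suc n * j"
    by (simp add: gauss_coeff_def)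
  finally show ?case
    using Suc by (simp add: j_def)
qed

text \<open>Truncation of the q-binomial series with coefficients
  \<open>gauss_coeff k = (-1; q)_k / (q; q)_k\<close> at \<open>z = q^(m+1)\<close>. The full series
  is \<open>(-z; q) / (z; q)\<close> with infinite products, that is \<open>eta_quot m\<close>
  divided by theta.\<close>

definition gauss_sum :: "nat \<Rightarrow> nat \<Rightarrow> rat fps" where
  "gauss_sum n m = (\<Sum>k\<le>n. gauss_coeff k * q ^ (Suc m * k))"

text \<open>Functional equation \<open>(1 - z) f(z) = (1 + z) f(z q)\<close> of the q-binomial
  series; truncation leaves one boundary term, divisible by \<open>z^(n+1)\<close>.\<close>

lemma gauss_sum_step:
  "agree (Suc n) ((1 - q ^ Suc m) * gauss_sum n m) ((1 + q ^ Suc m) * gauss_sum n (Suc m))"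
proof -
  define x where "x = q ^ Suc m"
  have "(1 - x) * (\<Sum>k\<le>n. gauss_coeff k * x ^ k) - (1 + x) * (\<Sum>k\<le>n. gauss_coeff k * (x * q) ^ k)
     = - gauss_coeff n * x ^ Suc n * (1 + q ^ n)"
  proof (induction n)
    case 0
    show ?case by (simp add: gauss_coeff_def algebra_simps)
  next
    case (Suc n)
    have "(1 - x) * (gauss_coeff (Suc n) * x ^ Suc n) - (1 + x) * (gauss_coeff (Suc n) * (x * q) ^ Suc n)
       = (1 - q ^ Suc n) * gauss_coeff (Suc n) * x ^ Suc n - gauss_coeff (Suc n) * x ^ Suc (Suc n) * (1 + q ^ Suc n)"
      by (simp add: algebra_simps power_mult_distrib)
    also have "(1 - q ^ Suc n) * gauss_coeff (Suc n) * x ^ Suc n = gauss_coeff n * x ^ Suc n * (1 + q ^ n)"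
      unfolding gauss_coeff_Suc by (simp only: mult_ac)
    finally have "(1 - x) * (gauss_coeff (Suc n) * x ^ Suc n) - (1 + x) * (gauss_coeff (Suc n) * (x * q) ^ Suc n)
       = gauss_coeff n * x ^ Suc n * (1 + q ^ n) - gauss_coeff (Suc n) * x ^ Suc (Suc n) * (1 + q ^ Suc n)" .
    moreover have "(1 - x) * (a + u) - (1 + x) * (b + v)
        = ((1 - x) * a - (1 + x) * b) + ((1 - x) * u - (1 + x) * v)" for a b u v
      by algebra
    ultimately show ?case
      by (simp only: sum.atMost_Suc Suc) simp
  qed
  moreover have x: "x ^ k = q ^ (Suc m * k)" for k
    by (simp only: x_def power_mult)
  moreover have "(x * q) ^ k = q ^ (Suc (Suc m) * k)" for k
    by (simp only: x_def power_mult power_Suc2 [of q "Suc m"])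
  ultimately have "(1 - x) * gauss_sum n m - (1 + x) * gauss_sum n (Suc m)
      = - gauss_coeff n * q ^ (Suc m * Suc n) * (1 + q ^ n)"
    unfolding gauss_sum_def by (simp only:)
  then have "(1 - q ^ Suc m) * gauss_sum n m - (1 + q ^ Suc m) * gauss_sum n (Suc m)
      = q ^ (Suc m * Suc n) * (- gauss_coeff n * (1 + q ^ n))"
    unfolding x_def by (simp only: mult_ac)
  moreover have "q ^ Suc n dvd q ^ (Suc m * Suc n)"
    by (intro le_imp_power_dvd) simp
  ultimately show ?thesis
    unfolding agree_def by (simp only: dvd_mult2)
qed

lemma gauss_sum_eta_quot: "agree (Suc n) (eta_quot m * gauss_sum n 0) (gauss_sum n m)"
proof (induction m)
  case 0
  show ?case by simp
next
  case (Suc m)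
  have "(1 + q ^ Suc m) * (eta_quot (Suc m) * gauss_sum n 0) = (1 - q ^ Suc m) * (eta_quot m * gauss_sum n 0)"
    using eta_quot_Suc [of m] by (simp only: mult.assoc [symmetric])
  also have "agree (Suc n) \<dots> ((1 - q ^ Suc m) * gauss_sum n m)"
    by (intro agree_mult_left Suc)
  also note gauss_sum_step
  finally show ?case
    by (rule agree_cancel_left) simp
qed

text \<open>At \<open>m = n\<close> every term with \<open>k > 0\<close> has exponent above
  \<open>n\<close>. Hence \<open>gauss_sum n 0\<close> inverts \<open>eta_quot n\<close> modulo
  \<open>q ^ Suc n\<close>.\<close>

lemma gauss_sum_last: "agree (Suc n) (gauss_sum n n) 1"
proof -
  have "agree (Suc n) (\<Sum>k\<le>n. gauss_coeff k * q ^ (Suc n * k)) (\<Sum>k\<le>n. if k = 0 then 1 else 0)"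
  proof (rule agree_sum)
    fix k
    have "agree (Suc n) (gauss_coeff k * q ^ (Suc n * k)) 0" if "k > 0"
      unfolding mult.commute [of "gauss_coeff k"] using that
      by (intro agree_power_mult_0) (cases k, simp_all)
    then show "agree (Suc n) (gauss_coeff k * q ^ (Suc n * k)) (if k = 0 then 1 else 0)"
      by (auto simp: gauss_coeff_def)
  qed
  then show ?thesis by (simp add: gauss_sum_def)
qed

text \<open>The series \<open>F\<close> restricted to largest part at most \<open>n\<close>, which
  is exact for the coefficients up to \<open>n\<close>.\<close>

definition alt_sum :: "nat \<Rightarrow> rat fps" where
  "alt_sum n = 1 + (\<Sum>m=1..n. (- 1) ^ m * (eta_quot m - eta_quot (m - 1)))"

text \<open>After exchanging the sums, each \<open>k\<close> carries a geometric series in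
  \<open>m\<close> of ratio \<open>- q ^ k\<close>. With \<open>x = q ^ k\<close> it contributes
  \<open>x - (x - 1) x / (1 + x) = 2 x / (1 + x)\<close>, the summand of
  \<open>lambert_kernel_eq\<close>.\<close>

lemma gauss_sum_alt_sum:
  "agree (Suc n) (gauss_sum n 0 + (\<Sum>m=1..n. (- 1) ^ m * (gauss_sum n m - gauss_sum n (m - 1))))
     ((npoch n)\<^sup>2 * lambert_kernel n)"
proof -
  define f where "f k = gauss_coeff k * (q ^ k + (\<Sum>m=1..n. (- 1) ^ m * (q ^ (Suc m * k) - q ^ (m * k))))" for k
  have "gauss_sum n 0 + (\<Sum>m=1..n. (- 1) ^ m * (gauss_sum n m - gauss_sum n (m - 1)))
      = (\<Sum>k\<le>n. gauss_coeff k * q ^ k) + (\<Sum>m=1..n. \<Sum>k\<le>n. (- 1) ^ m * (gauss_coeff k * (q ^ (Suc m * k) - q ^ (m * k))))"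
    unfolding gauss_sum_def
    by (intro arg_cong2 [where f = "(+)"] sum.cong refl)
       (auto simp: sum_subtractf sum_distrib_left right_diff_distrib)
  also have "\<dots> = (\<Sum>k\<le>n. f k)"
    by (subst sum.swap) (simp add: f_def sum.distrib sum_distrib_left distrib_left mult.left_commute)
  also have "\<dots> = f 0 + (\<Sum>k=1..n. f k)"
    by (simp add: sum.atMost_shift sum.atLeast1_atMost_eq)
  also have "f 0 = 1"
    by (simp add: f_def gauss_coeff_def)
  also have "agree (Suc n) (1 + (\<Sum>k=1..n. f k)) (1 + (\<Sum>k=1..n. 2 * gauss_coeff k * q ^ k * inverse (1 + q ^ k)))"
  proof (intro agree_add agree_refl agree_sum)
    fix k assume "k \<in> {1..n}"
    then have k: "k > 0" by simp
    define x where "x = q ^ k"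
    define j where "j = inverse (1 + x)"
    have j: "(1 + x) * j = 1"
      using inverse_one_plus_power [OF k] by (simp add: j_def x_def)
    have geo: "(1 + x) * (\<Sum>m=1..n. (- x) ^ m) = - x - (- x) ^ Suc n" for n
      by (induction n) (simp_all add: algebra_simps)
    have "(\<Sum>m=1..n. (- 1) ^ m * (q ^ (Suc m * k) - q ^ (m * k))) = (x - 1) * (\<Sum>m=1..n. (- x) ^ m)"
      unfolding sum_distrib_left
      by (intro sum.cong refl)
        (simp add: x_def power_mult [symmetric] power_add power_minus [of "q ^ k"] algebra_simps)
    also have "\<dots> = (x - 1) * (- x * j - (- x) ^ Suc n * j)"
    proof -
      have unit_solve: "s = y * j" if "(1 + x) * s = y" for s y
      proof -
        have "y * j = (1 + x) * j * s"
          unfolding that [symmetric] by (simp only: mult_ac)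
        then show ?thesis using j by simp
      qed
      have "(\<Sum>m=1..n. (- x) ^ m) = (- x - (- x) ^ Suc n) * j"
        by (rule unit_solve [OF geo])
      then show ?thesis by (simp only: left_diff_distrib)
    qed
    also have "agree (Suc n) \<dots> ((x - 1) * (- x * j - 0))"
    proof (intro agree_mult_left agree_diff agree_refl)
      have e: "(- x) ^ Suc n * j = q ^ (k * Suc n) * ((- 1) ^ Suc n * j)"
        by (simp only: x_def power_mult power_minus [of "q ^ k"] mult_ac)
      have "Suc n \<le> k * Suc n"
        using k by (cases k) simp_all
      then show "agree (Suc n) ((- x) ^ Suc n * j) 0"
        unfolding e by (rule agree_power_mult_0)
    qed
    finally have "agree (Suc n) (f k) (gauss_coeff k * (x + (x - 1) * (- x * j - 0)))"
      unfolding f_def x_def [symmetric] by (intro agree_mult_left agree_add agree_refl)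
    moreover have "gauss_coeff k * (x + (x - 1) * (- x * j - 0)) = 2 * gauss_coeff k * x * j"
      using j by algebra
    ultimately show "agree (Suc n) (f k) (2 * gauss_coeff k * q ^ k * inverse (1 + q ^ k))"
      by (simp only: x_def j_def)
  qed
  finally show ?thesis
    unfolding lambert_kernel_eq .
qed

text \<open>Multiplication by \<open>g\<close> replaces every \<open>eta_quot m\<close> by a
  \<open>gauss_sum\<close>, which is linear in powers of \<open>q ^ m\<close>; afterwards
  \<open>g\<close> is removed by its inverse \<open>eta_quot n\<close>.\<close>

lemma alt_sum_eta_quot:
  "agree (Suc n) (alt_sum n) (eta_quot n * ((npoch n)\<^sup>2 * lambert_kernel n))"
proof -
  define g where "g = gauss_sum n 0"
  have e: "agree (Suc n) (eta_quot m * g) (gauss_sum n m)" for m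
    unfolding g_def by (rule gauss_sum_eta_quot)
  have one: "agree (Suc n) 1 (eta_quot n * g)"
    using e [of n] gauss_sum_last agree_sym agree_trans by blast
  have "g * alt_sum n = g + (\<Sum>m=1..n. (- 1) ^ m * (eta_quot m * g - eta_quot (m - 1) * g))"
    unfolding alt_sum_def distrib_left sum_distrib_left mult_1_right
    by (intro arg_cong2 [where f = "(+)"] sum.cong refl) (simp add: algebra_simps)
  also have "agree (Suc n) \<dots> (g + (\<Sum>m=1..n. (- 1) ^ m * (gauss_sum n m - gauss_sum n (m - 1))))"
    by (intro agree_add agree_sum agree_mult_left agree_diff e agree_refl)
  also have "agree (Suc n) \<dots> ((npoch n)\<^sup>2 * lambert_kernel n)"
    unfolding g_def by (rule gauss_sum_alt_sum)
  finally have "agree (Suc n) (eta_quot n * (g * alt_sum n)) (eta_quot n * ((npoch n)\<^sup>2 * lambert_kernel n))"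
    by (rule agree_mult_left)
  moreover have "agree (Suc n) (1 * alt_sum n) (eta_quot n * g * alt_sum n)"
    by (intro agree_mult one agree_refl)
  ultimately show ?thesis
    unfolding mult.assoc mult_1 by (rule agree_trans [rotated])
qed

section \<open>Limits of the finite Bailey sums\<close>

lemma poch_add: "\<exists>e. poch (n + r) = poch n * (1 + q ^ Suc n * e)"
proof (induction r)
  case 0
  show ?case by (rule exI [of _ 0]) simp
next
  case (Suc r)
  then obtain e where "poch (n + r) = poch n * (1 + q ^ Suc n * e)" ..
  then have "poch (n + Suc r) = poch n * (1 + q ^ Suc n * (e - q ^ r * (1 + q ^ Suc n * e)))"
    by (simp add: poch_Suc power_add algebra_simps)
  then show ?case ..
qed

lemma poch_agree: "agree (Suc n) (poch (n + r)) (poch n)"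
proof -
  obtain e where "poch (n + r) = poch n * (1 + q ^ Suc n * e)"
    using poch_add by blast
  then have "poch (n + r) - poch n = q ^ Suc n * (poch n * e)"
    by (simp add: algebra_simps)
  then show ?thesis
    unfolding agree_def by (metis dvd_triv_left)
qed

lemma agree_power_shift: "agree n a b \<Longrightarrow> agree (m + n) (q ^ m * a) (q ^ m * b)"
  unfolding agree_def power_add by (simp add: right_diff_distrib [symmetric] mult_dvd_mono)

lemma agree_mono: "agree n a b \<Longrightarrow> m \<le> n \<Longrightarrow> agree m a b"
  unfolding agree_def by (meson dvd_trans le_imp_power_dvd)

text \<open>The normalised kernel is 1 only modulo \<open>q^(n-r+1)\<close>; the prefactor
  \<open>q^(r^2)\<close> makes up for the loss because \<open>r\<close> is at most
  \<open>r^2\<close>.\<close>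

lemma poch_bkernel:
  assumes "r \<le> n"
  shows "agree (Suc n) (q ^ (r\<^sup>2) * ((poch n)\<^sup>2 * bkernel n r)) (q ^ (r\<^sup>2))"
proof -
  have 1: "agree (Suc (n - r)) (poch n * inverse (poch (n - r))) 1"
    using agree_mult [OF poch_agree [of "n - r" r] agree_refl [of _ "inverse (poch (n - r))"]] assms
    by (simp add: inverse_poch)
  have 2: "agree (Suc n) (poch n * inverse (poch (n + r))) 1"
    using agree_mult [OF agree_sym [OF poch_agree [of n r]] agree_refl [of _ "inverse (poch (n + r))"]]
    by (simp add: inverse_poch)
  have "agree (Suc (n - r)) ((poch n * inverse (poch (n - r))) * (poch n * inverse (poch (n + r)))) (1 * 1)"
    by (intro agree_mult 1 agree_mono [OF 2]) simp
  then have "agree (Suc (n - r)) ((poch n)\<^sup>2 * bkernel n r) 1"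
    by (simp add: bkernel_def power2_eq_square mult_ac)
  from agree_power_shift [OF this, of "r\<^sup>2"] have "agree (r\<^sup>2 + Suc (n - r)) (q ^ (r\<^sup>2) * ((poch n)\<^sup>2 * bkernel n r)) (q ^ (r\<^sup>2))"
    by simp
  moreover have "Suc n \<le> r\<^sup>2 + Suc (n - r)"
  proof -
    have "r \<le> r\<^sup>2" by (simp add: power2_eq_square)
    then show ?thesis using assms by linarith
  qed
  ultimately show ?thesis by (rule agree_mono)
qed

definition theta :: "nat \<Rightarrow> rat fps" where
  "theta n = 1 + 2 * (\<Sum>r=1..n. (- 1) ^ r * q ^ (r\<^sup>2))"

definition lambert :: "nat \<Rightarrow> rat fps" where
  "lambert n = 1 + 8 * (\<Sum>r=1..n. (- 1) ^ r * q ^ (r\<^sup>2 + r) * (inverse (1 + q ^ r))\<^sup>2)"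

lemma poch_theta_kernel: "(poch n)\<^sup>2 * theta_kernel n = eta_quot n"
  using inverse_poch [of n] by (simp add: theta_kernel_eq eta_quot_def power2_eq_square mult_ac)

text \<open>Gauss's identity, as the limit of the closed form of
  \<open>theta_kernel\<close>.\<close>

lemma eta_quot_theta: "agree (Suc n) (eta_quot n) (theta n)"
proof -
  have "(poch n)\<^sup>2 * theta_kernel n
      = q ^ (0\<^sup>2) * ((poch n)\<^sup>2 * bkernel n 0)
        + 2 * (\<Sum>r=1..n. (- 1) ^ r * (q ^ (r\<^sup>2) * ((poch n)\<^sup>2 * bkernel n r)))"
    by (simp add: theta_kernel_def distrib_left sum_distrib_left mult_ac)
  also have "agree (Suc n) \<dots> (q ^ (0\<^sup>2) + 2 * (\<Sum>r=1..n. (- 1) ^ r * q ^ (r\<^sup>2)))"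
    by (intro agree_add agree_mult_left agree_sum poch_bkernel) auto
  finally show ?thesis
    unfolding poch_theta_kernel theta_def by simp
qed

lemma poch_lambert_kernel: "agree (Suc n) ((poch n)\<^sup>2 * lambert_kernel n) (lambert n)"
proof -
  define c where "c r = (- 1) ^ r * q ^ r * (inverse (1 + q ^ r))\<^sup>2" for r
  have 1: "(- 1) ^ r * q ^ (r\<^sup>2 + r) * (inverse (1 + q ^ r))\<^sup>2 = c r * q ^ (r\<^sup>2)" for r
    unfolding c_def power_add by (simp only: mult_ac)
  have "(poch n)\<^sup>2 * lambert_kernel n
      = q ^ (0\<^sup>2) * ((poch n)\<^sup>2 * bkernel n 0)
        + 8 * (\<Sum>r=1..n. c r * (q ^ (r\<^sup>2) * ((poch n)\<^sup>2 * bkernel n r)))"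
    unfolding lambert_kernel_def 1 distrib_left sum_distrib_left by (simp add: mult_ac)
  also have "agree (Suc n) \<dots> (q ^ (0\<^sup>2) + 8 * (\<Sum>r=1..n. c r * q ^ (r\<^sup>2)))"
    by (intro agree_add agree_mult_left agree_sum poch_bkernel) auto
  also have "\<dots> = lambert n"
    by (simp add: lambert_def 1)
  finally show ?thesis .
qed

text \<open>One \<open>eta_quot n\<close> comes from theta and one from \<open>alt_sum\<close>;
  their square turns \<open>(npoch n)\<^sup>2\<close> into \<open>(poch n)\<^sup>2\<close>, the
  normalisation under which the kernel sum tends to the Lambert series.\<close>

lemma theta_alt_sum: "agree (Suc n) (theta n * alt_sum n) (lambert n)"
proof -
  have "agree (Suc n) (theta n * alt_sum n) (eta_quot n * (eta_quot n * ((npoch n)\<^sup>2 * lambert_kernel n)))"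
    by (intro agree_mult alt_sum_eta_quot agree_sym [OF eta_quot_theta])
  also have "eta_quot n * (eta_quot n * ((npoch n)\<^sup>2 * lambert_kernel n)) = (poch n)\<^sup>2 * lambert_kernel n"
  proof -
    have "eta_quot n * (eta_quot n * ((npoch n)\<^sup>2 * lambert_kernel n))
        = (poch n)\<^sup>2 * (npoch n * inverse (npoch n))\<^sup>2 * lambert_kernel n"
      unfolding eta_quot_def power2_eq_square by (simp only: mult_ac)
    then show ?thesis by (simp add: inverse_npoch)
  qed
  also note poch_lambert_kernel
  finally show ?thesis .
qed

section \<open>The Hecke-type double sum\<close>

definition sgz :: "int \<Rightarrow> rat fps" where
  "sgz l = (if even l then 1 else - 1)"

lemma sgz_simps [simp]: "sgz 0 = 1" "sgz (- l) = sgz l" "sgz (int m) = (- 1) ^ m"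
  by (simp_all add: sgz_def)

text \<open>Negative exponents are sent to \<open>q ^ 0\<close>, so additivity needs the exponents
  to be nonnegative.\<close>

definition qpow :: "int \<Rightarrow> rat fps" where
  "qpow e = q ^ nat e"

lemma qpow_add: "e \<ge> 0 \<Longrightarrow> f \<ge> 0 \<Longrightarrow> qpow (e + f) = qpow e * qpow f"
  by (simp add: qpow_def nat_add_distrib power_add)

lemma qpow_agree_0: "int n < e \<Longrightarrow> agree (Suc n) (qpow e) 0"
  unfolding qpow_def by (rule agree_power_0) simp

text \<open>The \<open>q\<close>-analogue of the hyperbolic cotangent; it inherits the addition formula.\<close>

definition qcoth :: "nat \<Rightarrow> rat fps" where
  "qcoth k = (1 + q ^ (2 * k)) * inverse (1 - q ^ (2 * k))"

text \<open>Odd extension to the integers. The pole at 0 gets the value 0, which costs a correction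
  term when \<open>N = m\<close>.\<close>

definition qcothz :: "int \<Rightarrow> rat fps" where
  "qcothz k = (if k > 0 then qcoth (nat k) else if k < 0 then - qcoth (nat (- k)) else 0)"

lemma qcothz_0 [simp]: "qcothz 0 = 0"
  by (simp add: qcothz_def)

lemma qcothz_minus: "qcothz (- k) = - qcothz k"
  by (simp add: qcothz_def)

lemma qcothz_int: "k > 0 \<Longrightarrow> qcothz (int k) = qcoth k"
  by (simp add: qcothz_def)

lemma qcoth_add:
  assumes "a > 0" "b > 0"
  shows "qcoth a * qcoth b + 1 = qcoth (a + b) * (qcoth a + qcoth b)"
proof -
  have alg: "(1 + x) * i * ((1 + y) * j) + 1 = (1 + x * y) * k * ((1 + x) * i + (1 + y) * j)"
    if "(1 - x) * i = 1" "(1 - y) * j = 1" "(1 - x * y) * k = 1" for x y i j k :: "rat fps"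
    using that by algebra
  have "q ^ (2 * (a + b)) = q ^ (2 * a) * q ^ (2 * b)"
    by (simp add: power_add distrib_left)
  then show ?thesis
    unfolding qcoth_def
    using alg [of "q ^ (2 * a)" _ "q ^ (2 * b)"] inverse_one_minus_power [of "2 * a"]
      inverse_one_minus_power [of "2 * b"] inverse_one_minus_power [of "2 * (a + b)"] assms
    by simp
qed

text \<open>Adding the addition formulas for the shifts \<open>m\<close> and \<open>-m\<close>
  cancels \<open>qcoth N\<close> on the right, leaving a difference that telescopes in
  \<open>N\<close>. The cases are the two signs of \<open>N - m\<close>.\<close>

lemma qcoth_pair:
  assumes "N > 0" "m > 0" "N \<noteq> m"
  shows "qcoth N * (qcothz (int N - int m) + qcothz (int N + int m)) - 2
      = qcoth m * (qcothz (int N - int m) - qcothz (int N + int m))"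
proof -
  have p: "qcothz (int N + int m) = qcoth (N + m)"
    using qcothz_int [of "N + m"] assms by simp
  note 1 = qcoth_add [OF assms(1,2)]
  show ?thesis
  proof (cases "m < N")
    case True
    then have e: "qcothz (int N - int m) = qcoth (N - m)"
      using qcothz_int [of "N - m"] by (simp add: of_nat_diff)
    have "qcoth (N - m) * qcoth m + 1 = qcoth N * (qcoth (N - m) + qcoth m)"
      using qcoth_add [of "N - m" m] True assms by simp
    then show ?thesis
      using 1 unfolding p e by algebra
  next
    case False
    then have "m > N" using assms by simp
    then have "qcothz (int N - int m) = - qcoth (m - N)"
      using qcothz_int [of "m - N"] qcothz_minus [of "int m - int N"] by (simp add: of_nat_diff)
    moreover have "qcoth (m - N) * qcoth N + 1 = qcoth m * (qcoth (m - N) + qcoth N)"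
      using qcoth_add [of "m - N" N] \<open>m > N\<close> assms by simp
    ultimately show ?thesis
      using 1 unfolding p by algebra
  qed
qed

text \<open>At the replaced pole the duplication formula \<open>c(m)^2 + 1 = 2 c(m) c(2m)\<close>
  takes over and produces the extra \<open>qcoth m * qcoth m - 1\<close>.\<close>

lemma qcoth_pair_eq:
  assumes "m > 0"
  shows "qcoth m * (qcothz (int m - int m) + qcothz (int m + int m)) - 2
      = qcoth m * (qcothz (int m - int m) - qcothz (int m + int m)) + (qcoth m * qcoth m - 1)"
proof -
  have "qcothz (int m + int m) = qcoth (m + m)"
    using qcothz_int [of "m + m"] assms by simp
  with qcoth_add [OF assms assms] show ?thesis
    by simp algebra
qed

lemma sum_qcothz_symmetric: "(\<Sum>i\<in>{- int k..int k}. qcothz i) = 0"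
proof -
  have "(\<Sum>i\<in>{- int k..int k}. qcothz i) = (\<Sum>i\<in>{- int k..int k}. qcothz (- i))"
    by (rule sum.reindex_bij_witness [of _ uminus uminus]) auto
  also have "\<dots> = - (\<Sum>i\<in>{- int k..int k}. qcothz i)"
    by (simp add: qcothz_minus sum_negf)
  finally show ?thesis
    by (simp add: eq_neg_iff_add_eq_0 flip: mult_2)
qed

text \<open>Telescoping with step \<open>2 m\<close> leaves the window from \<open>1 - m\<close> to
  \<open>m\<close> minus its translate by \<open>M\<close>; by oddness the former reduces to its
  last entry \<open>qcoth m\<close>.\<close>

lemma sum_qcothz_shift:
  assumes "m > 0"
  shows "(\<Sum>N=1..M. qcothz (int N - int m) - qcothz (int N + int m))
     = qcoth m - (\<Sum>i\<in>{int M - int m + 1..int M + int m}. qcothz i)"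
proof (induction M)
  case 0
  have "{- int m + 1..int m} = insert (int m) {- int (m - 1)..int (m - 1)}"
    using assms by auto
  moreover have "int m \<notin> {- int (m - 1)..int (m - 1)}"
    using assms by auto
  ultimately have "(\<Sum>i\<in>{- int m + 1..int m}. qcothz i) = qcothz (int m) + 0"
    by (simp add: sum_qcothz_symmetric del: atLeastAtMost_iff)
  then show ?case
    using assms by (simp add: qcothz_int)
next
  case (Suc M)
  define S where "S = (\<Sum>i\<in>{int M - int m + 2..int M + int m}. qcothz i)"
  have "{int M - int m + 1..int M + int m} = insert (int M - int m + 1) {int M - int m + 2..int M + int m}"
    using assms by auto
  then have "(\<Sum>i\<in>{int M - int m + 1..int M + int m}. qcothz i) = qcothz (int M - int m + 1) + S"
    by (simp add: S_def)
  moreover have "{int (Suc M) - int m + 1..int (Suc M) + int m} = insert (int M + int m + 1) {int M - int m + 2..int M + int m}"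
    using assms by auto
  then have "(\<Sum>i\<in>{int (Suc M) - int m + 1..int (Suc M) + int m}. qcothz i) = qcothz (int M + int m + 1) + S"
    by (simp add: S_def)
  moreover have "int (Suc M) - int m = int M - int m + 1" "int (Suc M) + int m = int M + int m + 1"
    by simp_all
  then have "(\<Sum>N=1..Suc M. qcothz (int N - int m) - qcothz (int N + int m))
      = (\<Sum>N=1..M. qcothz (int N - int m) - qcothz (int N + int m))
         + (qcothz (int M - int m + 1) - qcothz (int M + int m + 1))"
    by (simp only: sum.cl_ivl_Suc) simp
  ultimately show ?case
    using Suc by simp
qed

lemma qcoth_agree_1:
  assumes "n < 2 * k"
  shows "agree (Suc n) (qcoth k) 1"
proof (rule agree_cancel_left)
  have "(1 - q ^ (2 * k)) * qcoth k = (1 + q ^ (2 * k)) * ((1 - q ^ (2 * k)) * inverse (1 - q ^ (2 * k)))"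
    unfolding qcoth_def by (simp only: mult_ac)
  also have "\<dots> = 1 + q ^ (2 * k)"
    using inverse_one_minus_power [of "2 * k"] assms by simp
  also have "agree (Suc n) \<dots> (1 + 0)"
    using assms by (intro agree_add agree_refl agree_power_0) simp
  also have "agree (Suc n) (1 + 0) (1 - q ^ (2 * k))"
    using agree_diff [OF agree_refl [of _ 1] agree_power_0 [of "Suc n" "2 * k"]] assms
    by (simp add: agree_sym)
  finally show "agree (Suc n) ((1 - q ^ (2 * k)) * qcoth k) ((1 - q ^ (2 * k)) * 1)"
    by simp
  show "fps_nth (1 - q ^ (2 * k)) 0 \<noteq> 0"
    using assms by simp
qed

text \<open>With upper limit \<open>2 * n\<close> all \<open>2 * m\<close> indices in the final
  window exceed \<open>n\<close>, so each value there is congruent to 1.\<close>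

lemma sum_qcoth_pair:
  assumes "m > 0" "m \<le> n"
  shows "agree (Suc n)
     (\<Sum>N=1..2*n. qcoth N * (qcothz (int N - int m) + qcothz (int N + int m)) - 2)
     (2 * (qcoth m * qcoth m) - of_nat (2 * m) * qcoth m - 1)"
proof -
  define f where "f N = qcoth m * (qcothz (int N - int m) - qcothz (int N + int m))" for N
  have "(\<Sum>N=1..2*n. qcoth N * (qcothz (int N - int m) + qcothz (int N + int m)) - 2)
      = (\<Sum>N=1..2*n. f N + (if N = m then qcoth m * qcoth m - 1 else 0))"
  proof (rule sum.cong)
    fix N assume "N \<in> {1..2*n}"
    then show "qcoth N * (qcothz (int N - int m) + qcothz (int N + int m)) - 2
        = f N + (if N = m then qcoth m * qcoth m - 1 else 0)"
      using qcoth_pair [of N m] qcoth_pair_eq [OF assms(1)] assms(1) unfolding f_def by auto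
  qed simp
  also have "\<dots> = qcoth m * (\<Sum>N=1..2*n. qcothz (int N - int m) - qcothz (int N + int m))
      + (qcoth m * qcoth m - 1)"
    using assms by (simp add: sum.distrib sum_distrib_left f_def)
  also have "agree (Suc n) \<dots> (qcoth m * (qcoth m - of_nat (2 * m)) + (qcoth m * qcoth m - 1))"
  proof (intro agree_add agree_mult_left agree_refl)
    have "agree (Suc n) (\<Sum>i\<in>{int (2*n) - int m + 1..int (2*n) + int m}. qcothz i)
       (\<Sum>i\<in>{int (2*n) - int m + 1..int (2*n) + int m}. 1)"
    proof (rule agree_sum)
      fix i assume "i \<in> {int (2*n) - int m + 1..int (2*n) + int m}"
      then have "i > 0" "n < 2 * nat i"
        using assms by auto
      then show "agree (Suc n) (qcothz i) 1"
        using qcoth_agree_1 [of n "nat i"] by (simp add: qcothz_def)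
    qed
    also have "(\<Sum>i\<in>{int (2*n) - int m + 1..int (2*n) + int m}. 1) = (of_nat (2 * m) :: rat fps)"
      by (simp only: sum_constant card_atLeastAtMost_int) simp
    finally show "agree (Suc n) (\<Sum>N=1..2*n. qcothz (int N - int m) - qcothz (int N + int m)) (qcoth m - of_nat (2 * m))"
      unfolding sum_qcothz_shift [OF assms(1)] by (intro agree_diff agree_refl)
  qed
  also have "qcoth m * (qcoth m - of_nat (2 * m)) + (qcoth m * qcoth m - 1)
     = 2 * (qcoth m * qcoth m) - of_nat (2 * m) * qcoth m - 1"
    by (simp only: algebra_simps) simp
  finally show ?thesis .
qed


section \<open>The Hecke-type sums multiplied by theta\<close>

definition hecke_term :: "nat \<Rightarrow> int \<Rightarrow> rat fps" where
  "hecke_term N j = sgz (int N + j) * qpow ((int N)\<^sup>2 - j\<^sup>2)"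

text \<open>Trapezoidal sum over \<open>j\<close> from \<open>-N\<close> to \<open>N\<close>: inner
  terms count twice, the two end terms once. These end weights become the weights of zero entries in
  \<open>wt\<close>.\<close>

definition hecke :: "nat \<Rightarrow> rat fps" where
  "hecke N = (\<Sum>j\<in>{- int N..<int N}. hecke_term N j + hecke_term N (j + 1))"

lemma sum_symmetric_int:
  "(\<Sum>l\<in>{- int n..int n}. f l) = f 0 + (\<Sum>m=1..n. f (int m) + f (- int m) :: 'a :: ab_group_add)"
proof (induction n)
  case (Suc n)
  have "{- int (Suc n)..int (Suc n)} = insert (int (Suc n)) (insert (- int (Suc n)) {- int n..int n})"
    by auto
  then have "(\<Sum>l\<in>{- int (Suc n)..int (Suc n)}. f l) = f (int (Suc n)) + (f (- int (Suc n)) + (\<Sum>l\<in>{- int n..int n}. f l))"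
    by (simp del: of_nat_Suc)
  then show ?case
    using Suc by (simp add: add_ac del: of_nat_Suc)
qed simp

lemma theta_eq: "theta n = (\<Sum>l\<in>{- int n..int n}. sgz l * qpow (l\<^sup>2))"
  unfolding sum_symmetric_int theta_def sum_distrib_left
  by (intro arg_cong2 [where f = "(+)"] sum.cong refl) (simp_all add: qpow_def nat_power_eq)

lemma sq_diff_nonneg: "- N \<le> j \<Longrightarrow> j \<le> N \<Longrightarrow> 0 \<le> N\<^sup>2 - j\<^sup>2" for N j :: int
  by (simp add: power2_le_iff_abs_le)

text \<open>Putting \<open>k = s + j\<close> in \<open>s^2 + N^2 - j^2\<close> makes the exponent
  linear in \<open>j\<close> and the sign independent of it. The range of \<open>k\<close> may then
  be taken independent of \<open>j\<close>, as the added exponents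
  \<open>(k - j)^2 + (N^2 - j^2)\<close> exceed \<open>n\<close>.\<close>

lemma theta_hecke_term:
  assumes "- int N \<le> j" "j \<le> int N"
  shows "agree (Suc n) (theta n * hecke_term N j)
     (\<Sum>k\<in>{- int (n + N)..int (n + N)}. sgz (k + int N) * qpow ((int N)\<^sup>2 + k\<^sup>2 - 2 * j * k))"
proof -
  define g where "g k = sgz (k + int N) * qpow ((int N)\<^sup>2 + k\<^sup>2 - 2 * j * k)" for k
  have nonneg: "(int N)\<^sup>2 - j\<^sup>2 \<ge> 0"
    by (rule sq_diff_nonneg [OF assms])
  have "theta n * hecke_term N j = (\<Sum>s\<in>{- int n..int n}. g (s + j))"
    unfolding theta_eq sum_distrib_right
  proof (rule sum.cong [OF refl])
    fix s
    have "(int N)\<^sup>2 + (s + j)\<^sup>2 - 2 * j * (s + j) = s\<^sup>2 + ((int N)\<^sup>2 - j\<^sup>2)"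
      by (simp add: power2_eq_square algebra_simps)
    moreover have "sgz (s + j + int N) = sgz s * sgz (int N + j)"
      by (simp add: sgz_def)
    ultimately have "g (s + j) = sgz s * sgz (int N + j) * (qpow (s\<^sup>2) * qpow ((int N)\<^sup>2 - j\<^sup>2))"
      unfolding g_def by (simp only: qpow_add [OF zero_le_power2 nonneg])
    then show "sgz s * qpow (s\<^sup>2) * hecke_term N j = g (s + j)"
      by (simp only: hecke_term_def mult_ac)
  qed
  also have "\<dots> = (\<Sum>k\<in>{j - int n..j + int n}. g k)"
    by (rule sum.reindex_bij_witness [of _ "\<lambda>k. k - j" "\<lambda>s. s + j"]) auto
  also have "agree (Suc n) \<dots> (\<Sum>k\<in>{- int (n + N)..int (n + N)}. g k)"
  proof (rule agree_sum_mono_neutral)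
    fix k assume "k \<in> {- int (n + N)..int (n + N)} - {j - int n..j + int n}"
    then have "int n < \<bar>k - j\<bar>"
      by auto
    also have "\<dots> \<le> \<bar>k - j\<bar> * \<bar>k - j\<bar>"
      using calculation by (intro mult_le_cancel_left1 [THEN iffD2]) auto
    also have "\<dots> \<le> (int N)\<^sup>2 + k\<^sup>2 - 2 * j * k"
      using nonneg by (simp add: power2_eq_square algebra_simps)
    finally show "agree (Suc n) (g k) 0"
      unfolding g_def using agree_mult_left [OF qpow_agree_0] by fastforce
  qed (use assms in auto)
  finally show ?thesis
    by (simp only: g_def)
qed

lemma qcoth_mult: "k > 0 \<Longrightarrow> (1 - q ^ (2 * k)) * qcoth k = 1 + q ^ (2 * k)"
  using inverse_one_minus_power [of "2 * k"] unfolding qcoth_def by (simp add: mult.left_commute)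

text \<open>The trapezoidal weights turn a geometric sum into a multiple of \<open>coth\<close>.\<close>

lemma trapezoid_sum:
  assumes "k \<noteq> 0"
  shows "(\<Sum>j\<in>{- int N..<int N}. qpow ((int N)\<^sup>2 + k\<^sup>2 - 2 * j * k) + qpow ((int N)\<^sup>2 + k\<^sup>2 - 2 * (j + 1) * k))
     = qcothz k * (qpow ((int N - k)\<^sup>2) - qpow ((int N + k)\<^sup>2))"
proof -
  define f where "f j = qpow ((int N)\<^sup>2 + k\<^sup>2 - 2 * j * k)" for j
  define c where "c = nat \<bar>k\<bar>"
  have nonneg: "0 \<le> (int N)\<^sup>2 + k\<^sup>2 - 2 * j * k" if "- int N \<le> j" "j \<le> int N" for j
  proof -
    have "0 \<le> (k - j)\<^sup>2 + ((int N)\<^sup>2 - j\<^sup>2)"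
      using sq_diff_nonneg [OF that] by (intro add_nonneg_nonneg) auto
    then show ?thesis by (simp add: power2_eq_square algebra_simps)
  qed
  \<comment> \<open>Consecutive values have the constant ratio \<open>q ^ (2 * k)\<close> or its
    inverse, so their sum is a multiple of their difference, and differences telescope.\<close>
  have step: "f j + f (j + 1) = qcothz k * (f (j + 1) - f j)" if "- int N \<le> j" "j < int N" for j
  proof (cases "k > 0")
    case True
    have "(int N)\<^sup>2 + k\<^sup>2 - 2 * j * k = 2 * k + ((int N)\<^sup>2 + k\<^sup>2 - 2 * (j + 1) * k)"
      by (simp add: algebra_simps)
    then have "f j = q ^ (2 * c) * f (j + 1)"
      using nonneg [of "j + 1"] True that
      by (simp only: f_def qpow_add [of "2 * k"]) (simp add: qpow_def c_def nat_mult_distrib)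
    moreover have "qcothz k = qcoth c"
      using True by (simp add: qcothz_def c_def)
    moreover have "(1 - q ^ (2 * c)) * qcoth c = 1 + q ^ (2 * c)"
      using True by (intro qcoth_mult) (simp add: c_def)
    moreover have "a + b = d * (b - a)" if "a = x * b" "(1 - x) * d = 1 + x" for a b d x :: "rat fps"
      using that by algebra
    ultimately show ?thesis by metis
  next
    case False
    have "(int N)\<^sup>2 + k\<^sup>2 - 2 * (j + 1) * k = 2 * (- k) + ((int N)\<^sup>2 + k\<^sup>2 - 2 * j * k)"
      by (simp add: algebra_simps)
    then have "f (j + 1) = q ^ (2 * c) * f j"
      using nonneg [of j] False that
      by (simp only: f_def qpow_add [of "2 * (- k)"]) (simp add: qpow_def c_def nat_mult_distrib)
    moreover have "qcothz k = - qcoth c"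
      using False assms by (simp add: qcothz_def c_def)
    moreover have "(1 - q ^ (2 * c)) * qcoth c = 1 + q ^ (2 * c)"
      using False assms by (intro qcoth_mult) (simp add: c_def)
    moreover have "a + b = - d * (b - a)" if "b = x * a" "(1 - x) * d = 1 + x" for a b d x :: "rat fps"
      using that by algebra
    ultimately show ?thesis by metis
  qed
  have tel: "(\<Sum>j\<in>{a..<a + int m}. f (j + 1) - f j) = f (a + int m) - f a" for a m
  proof (induction m)
    case (Suc m)
    have "{a..<a + int (Suc m)} = insert (a + int m) {a..<a + int m}"
      by auto
    then show ?case using Suc by (simp add: add_ac)
  qed simp
  have "(\<Sum>j\<in>{- int N..<int N}. f j + f (j + 1)) = qcothz k * (\<Sum>j\<in>{- int N..<int N}. f (j + 1) - f j)"
    unfolding sum_distrib_left by (rule sum.cong) (auto intro: step)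
  also have "\<dots> = qcothz k * (f (int N) - f (- int N))"
    using tel [of "- int N" "2 * N"] by simp
  also have "f (int N) = qpow ((int N - k)\<^sup>2)"
    by (simp add: f_def power2_eq_square algebra_simps)
  also have "f (- int N) = qpow ((int N + k)\<^sup>2)"
    by (simp add: f_def power2_eq_square algebra_simps)
  finally show ?thesis
    by (simp only: f_def)
qed

text \<open>For each \<open>k\<close> the sum over \<open>j\<close> is geometric;
  \<open>k = 0\<close> is the degenerate ratio 1 and yields the term with factor
  \<open>4 * N\<close>. The others give \<open>c(k)\<close> times powers with exponents
  \<open>(N - k)^2\<close> and \<open>(N + k)^2\<close>.\<close>

lemma theta_hecke:
  "agree (Suc n) (theta n * hecke N)
     (of_nat (4 * N) * (- 1) ^ N * q ^ (N\<^sup>2)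
       + 2 * (qcothz (int N) + (\<Sum>m=1..n. (- 1) ^ m * q ^ (m\<^sup>2) * (qcothz (int N - int m) + qcothz (int N + int m)))))"
proof -
  define K where "K = {- int (n + N)..int (n + N)}"
  define g where "g k j = sgz (k + int N) * qpow ((int N)\<^sup>2 + k\<^sup>2 - 2 * j * k)" for k j
  define h where "h k = sgz (k + int N) * (qcothz k * qpow ((int N - k)\<^sup>2))" for k
  define p where "p l = sgz l * (qcothz (int N - l) * qpow (l\<^sup>2))" for l
  have p: "agree (Suc n) (\<Sum>l\<in>{- int n..2 * int N + int n}. p l) (\<Sum>l\<in>{- int n..int n}. p l)"
  proof (rule agree_sum_mono_neutral)
    fix l assume "l \<in> {- int n..2 * int N + int n} - {- int n..int n}"
    then have l: "l > int n" by auto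
    then have "l * 1 \<le> l * l"
      by (intro mult_left_mono) auto
    with l have "int n < l\<^sup>2"
      unfolding power2_eq_square by linarith
    then have "agree (Suc n) (sgz l * (qcothz (int N - l) * qpow (l\<^sup>2))) (sgz l * (qcothz (int N - l) * 0))"
      by (intro agree_mult_left qpow_agree_0)
    then show "agree (Suc n) (p l) 0"
      by (simp add: p_def)
  qed auto
  have "theta n * hecke N = (\<Sum>j\<in>{- int N..<int N}. theta n * hecke_term N j + theta n * hecke_term N (j + 1))"
    by (simp add: hecke_def sum_distrib_left distrib_left)
  also have "agree (Suc n) \<dots> (\<Sum>j\<in>{- int N..<int N}. (\<Sum>k\<in>K. g k j) + (\<Sum>k\<in>K. g k (j + 1)))"
    unfolding K_def g_def by (intro agree_sum agree_add theta_hecke_term) auto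
  also have "\<dots> = (\<Sum>k\<in>K. \<Sum>j\<in>{- int N..<int N}. g k j + g k (j + 1))"
    unfolding sum.distrib [symmetric] by (rule sum.swap)
  also have "\<dots> = (\<Sum>k\<in>K. (if k = 0 then of_nat (4 * N) * (- 1) ^ N * q ^ (N\<^sup>2) else 0) + (h k + h (- k)))"
  proof (rule sum.cong [OF refl])
    fix k
    show "(\<Sum>j\<in>{- int N..<int N}. g k j + g k (j + 1))
      = (if k = 0 then of_nat (4 * N) * (- 1) ^ N * q ^ (N\<^sup>2) else 0) + (h k + h (- k))"
    proof (cases "k = 0")
      case True
      then show ?thesis
        by (simp add: g_def h_def qpow_def nat_power_eq algebra_simps)
    next
      case False
      have "(\<Sum>j\<in>{- int N..<int N}. g k j + g k (j + 1))
         = sgz (k + int N) * (qcothz k * (qpow ((int N - k)\<^sup>2) - qpow ((int N + k)\<^sup>2)))"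
        unfolding trapezoid_sum [OF False, symmetric] sum_distrib_left g_def by (simp only: distrib_left)
      also have "\<dots> = h k + h (- k)"
        by (simp add: h_def qcothz_minus right_diff_distrib sgz_def)
      finally show ?thesis using False by simp
    qed
  qed
  also have "\<dots> = of_nat (4 * N) * (- 1) ^ N * q ^ (N\<^sup>2) + ((\<Sum>k\<in>K. h k) + (\<Sum>k\<in>K. h (- k)))"
    by (simp add: sum.distrib K_def)
  also have "(\<Sum>k\<in>K. h (- k)) = (\<Sum>k\<in>K. h k)"
    by (rule sum.reindex_bij_witness [of _ uminus uminus]) (auto simp: K_def)
  \<comment> \<open>The substitution \<open>l = N - k\<close> turns the exponent into
    \<open>l^2\<close> and the factor into \<open>c(N - l)\<close>.\<close>
  also have "(\<Sum>k\<in>K. h k) = (\<Sum>l\<in>{- int n..2 * int N + int n}. p l)"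
    by (rule sum.reindex_bij_witness [of _ "\<lambda>l. int N - l" "\<lambda>k. int N - k"])
       (auto simp: K_def h_def p_def sgz_def)
  also have "agree (Suc n) (of_nat (4 * N) * (- 1) ^ N * q ^ (N\<^sup>2)
        + ((\<Sum>l\<in>{- int n..2 * int N + int n}. p l) + (\<Sum>l\<in>{- int n..2 * int N + int n}. p l)))
      (of_nat (4 * N) * (- 1) ^ N * q ^ (N\<^sup>2)
        + ((\<Sum>l\<in>{- int n..int n}. p l) + (\<Sum>l\<in>{- int n..int n}. p l)))"
    by (intro agree_add agree_refl p)
  also have "(\<Sum>l\<in>{- int n..int n}. p l)
     = qcothz (int N) + (\<Sum>m=1..n. (- 1) ^ m * q ^ (m\<^sup>2) * (qcothz (int N - int m) + qcothz (int N + int m)))"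
    unfolding sum_symmetric_int
    by (intro arg_cong2 [where f = "(+)"] sum.cong refl)
       (simp_all add: p_def qpow_def nat_power_eq algebra_simps)
  finally show ?thesis
    by (simp only: mult_2)
qed


text \<open>Since theta is itself a sum over \<open>m\<close>, the term \<open>2 * theta n\<close>
  distributes one \<open>- 2\<close> to each \<open>m\<close>, as the addition formula requires;
  then the sum over \<open>N\<close> is evaluated inside the sum over \<open>m\<close>.\<close>

lemma theta_sum_hecke:
  "agree (Suc n) (theta n * (1 - (\<Sum>N=1..2*n. qcoth N * hecke N - 2)))
     (1 - 2 * (\<Sum>N=1..2*n. qcoth N * qcoth N - 1)
        - 4 * (\<Sum>m=1..n. (- 1) ^ m * q ^ (m\<^sup>2) * (qcoth m * qcoth m - 1)))"
proof -
  define s where "s N = of_nat (2 * N) * qcoth N * ((- 1) ^ N * q ^ (N\<^sup>2))" for N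
  define d where "d N m = qcoth N * (qcothz (int N - int m) + qcothz (int N + int m)) - 2" for N m
  define c where "c m = (- 1) ^ m * q ^ (m\<^sup>2)" for m
  have theta: "theta n = 1 + 2 * (\<Sum>m=1..n. c m)"
    by (simp add: theta_def c_def)
  have s: "s N = of_nat (2 * N) * qcoth N * c N" for N
    by (simp add: s_def c_def)
  have "theta n * (1 - (\<Sum>N=1..2*n. qcoth N * hecke N - 2))
     = theta n - (\<Sum>N=1..2*n. qcoth N * (theta n * hecke N) - 2 * theta n)"
    by (simp add: right_diff_distrib sum_distrib_left sum_subtractf mult_ac)
  also have "agree (Suc n) \<dots> (theta n - (\<Sum>N=1..2*n. 2 * (s N + (qcoth N * qcoth N - 1) + (\<Sum>m=1..n. c m * d N m))))"
  proof (intro agree_diff agree_refl agree_sum)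
    fix N assume "N \<in> {1..2*n}"
    then have N: "qcothz (int N) = qcoth N"
      by (simp add: qcothz_int)
    have "agree (Suc n) (qcoth N * (theta n * hecke N) - 2 * theta n)
      (qcoth N * (of_nat (4 * N) * (- 1) ^ N * q ^ (N\<^sup>2)
       + 2 * (qcothz (int N) + (\<Sum>m=1..n. (- 1) ^ m * q ^ (m\<^sup>2) * (qcothz (int N - int m) + qcothz (int N + int m)))))
       - 2 * theta n)"
      by (intro agree_diff agree_mult_left agree_refl theta_hecke)
    also have "\<dots> = 2 * (s N + (qcoth N * qcoth N - 1) + (\<Sum>m=1..n. c m * d N m))"
    proof -
      have 1: "(\<Sum>m=1..n. c m * d N m) = qcoth N * (\<Sum>m=1..n. c m * (qcothz (int N - int m) + qcothz (int N + int m))) - 2 * (\<Sum>m=1..n. c m)"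
        by (simp add: d_def sum_distrib_left sum_subtractf right_diff_distrib mult_ac)
      have 2: "of_nat (4 * N) * (- 1) ^ N * q ^ (N\<^sup>2) = 2 * of_nat (2 * N) * c N"
        by (simp add: c_def)
      show ?thesis
        unfolding 1 2 N theta s c_def [symmetric] by algebra
    qed
    finally show "agree (Suc n) (qcoth N * (theta n * hecke N) - 2 * theta n)
       (2 * (s N + (qcoth N * qcoth N - 1) + (\<Sum>m=1..n. c m * d N m)))" .
  qed
  also have "\<dots> = theta n - (2 * (\<Sum>N=1..2*n. s N) + 2 * (\<Sum>N=1..2*n. qcoth N * qcoth N - 1)
       + 2 * (\<Sum>m=1..n. c m * (\<Sum>N=1..2*n. d N m)))"
  proof -
    have "(\<Sum>m=1..n. c m * (\<Sum>N=1..2*n. d N m)) = (\<Sum>N=1..2*n. \<Sum>m=1..n. c m * d N m)"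
      unfolding sum_distrib_left by (rule sum.swap)
    then show ?thesis
      by (simp only: sum_distrib_left [symmetric] sum.distrib distrib_left)
  qed
  also have "agree (Suc n) \<dots> (theta n - (2 * (\<Sum>N=1..n. s N) + 2 * (\<Sum>N=1..2*n. qcoth N * qcoth N - 1)
       + 2 * (\<Sum>m=1..n. c m * (2 * (qcoth m * qcoth m) - of_nat (2 * m) * qcoth m - 1))))"
  proof (intro agree_diff agree_add agree_mult_left agree_sum agree_refl agree_sum_mono_neutral)
    fix N assume "N \<in> {1..2*n} - {1..n}"
    then have "Suc n \<le> N" by auto
    also have "N \<le> N\<^sup>2" by (simp add: power2_eq_square)
    finally have "agree (Suc n) (q ^ (N\<^sup>2) * (of_nat (2 * N) * qcoth N * (- 1) ^ N)) 0"
      by (rule agree_power_mult_0)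
    then show "agree (Suc n) (s N) 0"
      by (simp add: s_def mult_ac)
  next
    fix m assume "m \<in> {1..n}"
    then show "agree (Suc n) (\<Sum>N=1..2*n. d N m) (2 * (qcoth m * qcoth m) - of_nat (2 * m) * qcoth m - 1)"
      unfolding d_def by (intro sum_qcoth_pair) auto
  qed auto
  also have "\<dots> = 1 - 2 * (\<Sum>N=1..2*n. qcoth N * qcoth N - 1) - 4 * (\<Sum>m=1..n. c m * (qcoth m * qcoth m - 1))"
  proof -
    \<comment> \<open>The non-Lambert terms \<open>s\<close>, with their factor
      \<open>2 * N\<close>, cancel against the lengths \<open>2 * m\<close> of the telescoping
      windows.\<close>
    have 1: "(\<Sum>m=1..n. c m * (2 * (qcoth m * qcoth m) - of_nat (2 * m) * qcoth m - 1))
       = 2 * (\<Sum>m=1..n. c m * (qcoth m * qcoth m - 1)) + (\<Sum>m=1..n. c m) - (\<Sum>N=1..n. s N)"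
      unfolding sum_distrib_left sum.distrib [symmetric] sum_subtractf [symmetric]
      by (intro sum.cong refl) (simp add: s algebra_simps)
    show ?thesis
      unfolding 1 theta by algebra
  qed
  finally show ?thesis
    by (simp only: c_def)
qed

section \<open>Divisor sums that identify the two Lambert series\<close>

lemma agreeI_nth:
  assumes "\<And>i. i < n \<Longrightarrow> fps_nth a i = fps_nth b i"
  shows "agree n a b"
proof -
  have "fps_cutoff n (a - b) = 0"
    using assms by (intro fps_ext) simp
  then have "a - b = fps_shift n (a - b) * q ^ n"
    using fps_shift_cutoff [of n "a - b"] by simp
  then show ?thesis
    unfolding agree_def by (metis dvd_triv_right)
qed

lemma odd_power_sum:
  fixes y :: "'a :: comm_ring_1"
  shows "(1 - y\<^sup>2)\<^sup>2 * (\<Sum>i\<le>n. of_nat (2 * i + 1) * y ^ (2 * i + 1))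
    = y * (1 + y\<^sup>2) + y ^ (2 * n + 2) * (of_nat (2 * n + 1) * y ^ 3 - of_nat (2 * n + 3) * y)"
proof (induction n)
  case 0
  show ?case by (simp add: algebra_simps eval_nat_numeral)
next
  case (Suc n)
  have "(1 - y\<^sup>2)\<^sup>2 * (of_nat (2 * Suc n + 1) * y ^ (2 * Suc n + 1))
      + y ^ (2 * n + 2) * (of_nat (2 * n + 1) * y ^ 3 - of_nat (2 * n + 3) * y)
     = y ^ (2 * Suc n + 2) * (of_nat (2 * Suc n + 1) * y ^ 3 - of_nat (2 * Suc n + 3) * y)"
    by (simp add: algebra_simps eval_nat_numeral)
  then show ?case
    by (simp only: sum.atMost_Suc distrib_left Suc add.assoc add.commute [of "y ^ (2 * n + 2) * _"])
qed

lemma power_sum: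
  fixes x :: "'a :: comm_ring_1"
  shows "(1 - x)\<^sup>2 * (\<Sum>i=1..n. of_nat i * x ^ i) = x + x ^ Suc n * (of_nat n * x - of_nat (Suc n))"
proof (induction n)
  case 0
  show ?case by simp
next
  case (Suc n)
  have "(1 - x)\<^sup>2 * (of_nat (Suc n) * x ^ Suc n) + x ^ Suc n * (of_nat n * x - of_nat (Suc n))
     = x ^ Suc (Suc n) * (of_nat (Suc n) * x - of_nat (Suc (Suc n)))"
    by (simp add: algebra_simps power2_eq_square)
  moreover have "(\<Sum>i=1..Suc n. of_nat i * x ^ i) = (\<Sum>i=1..n. of_nat i * x ^ i) + of_nat (Suc n) * x ^ Suc n"
    by simp
  ultimately show ?case
    by (simp only: distrib_left Suc add.assoc add.commute [of "x ^ Suc n * (of_nat n * x - _)"])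
qed

lemma odd_lambert_expansion:
  assumes "r > 0"
  shows "agree (Suc n) (q ^ r * (1 + q ^ (2 * r)) * (inverse (1 - q ^ (2 * r)))\<^sup>2)
     (\<Sum>i\<le>n. of_nat (2 * i + 1) * q ^ (r * (2 * i + 1)))"
proof (rule agree_cancel_left)
  define s where "s = (\<Sum>i\<le>n. of_nat (2 * i + 1) * q ^ (r * (2 * i + 1)))"
  have sq: "q ^ (2 * r) = (q ^ r)\<^sup>2"
    by (simp add: power_mult [symmetric] mult.commute)
  have "(1 - q ^ (2 * r))\<^sup>2 * s = q ^ r * (1 + q ^ (2 * r))
      + (q ^ r) ^ (2 * n + 2) * (of_nat (2 * n + 1) * (q ^ r) ^ 3 - of_nat (2 * n + 3) * q ^ r)"
    unfolding s_def sq power_mult [of q r] by (rule odd_power_sum)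
  also have "agree (Suc n) \<dots> (q ^ r * (1 + q ^ (2 * r)) + 0)"
  proof (intro agree_add agree_refl)
    have "Suc n \<le> r * (2 * n + 2)"
      using assms by (cases r) auto
    then show "agree (Suc n) ((q ^ r) ^ (2 * n + 2) * (of_nat (2 * n + 1) * (q ^ r) ^ 3 - of_nat (2 * n + 3) * q ^ r)) 0"
      unfolding power_mult [symmetric] by (rule agree_power_mult_0)
  qed
  also have "q ^ r * (1 + q ^ (2 * r)) + 0
      = ((1 - q ^ (2 * r)) * inverse (1 - q ^ (2 * r)))\<^sup>2 * (q ^ r * (1 + q ^ (2 * r)))"
    using inverse_one_minus_power [of "2 * r"] assms by simp
  also have "\<dots> = (1 - q ^ (2 * r))\<^sup>2 * (q ^ r * (1 + q ^ (2 * r)) * (inverse (1 - q ^ (2 * r)))\<^sup>2)"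
    by (simp only: power_mult_distrib mult_ac)
  finally show "agree (Suc n) ((1 - q ^ (2 * r))\<^sup>2 * (q ^ r * (1 + q ^ (2 * r)) * (inverse (1 - q ^ (2 * r)))\<^sup>2))
     ((1 - q ^ (2 * r))\<^sup>2 * (\<Sum>i\<le>n. of_nat (2 * i + 1) * q ^ (r * (2 * i + 1))))"
    unfolding s_def by (rule agree_sym)
  show "fps_nth ((1 - q ^ (2 * r))\<^sup>2) 0 \<noteq> 0"
    using assms by (simp add: fps_nth_power_0 power_0_left)
qed

lemma lambert_expansion:
  assumes "r > 0"
  shows "agree (Suc n) (q ^ (2 * r) * (inverse (1 - q ^ (2 * r)))\<^sup>2) (\<Sum>i=1..n. of_nat i * q ^ (2 * r * i))"
proof (rule agree_cancel_left)
  define s where "s = (\<Sum>i=1..n. of_nat i * q ^ (2 * r * i))"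
  have "(1 - q ^ (2 * r))\<^sup>2 * s = q ^ (2 * r) + (q ^ (2 * r)) ^ Suc n * (of_nat n * q ^ (2 * r) - of_nat (Suc n))"
    unfolding s_def power_mult [of q "2 * r"] by (rule power_sum)
  also have "agree (Suc n) \<dots> (q ^ (2 * r) + 0)"
  proof (intro agree_add agree_refl)
    have "Suc n \<le> 2 * r * Suc n"
      using assms by (cases r) auto
    then show "agree (Suc n) ((q ^ (2 * r)) ^ Suc n * (of_nat n * q ^ (2 * r) - of_nat (Suc n))) 0"
      unfolding power_mult [symmetric] by (rule agree_power_mult_0)
  qed
  also have "q ^ (2 * r) + 0 = ((1 - q ^ (2 * r)) * inverse (1 - q ^ (2 * r)))\<^sup>2 * q ^ (2 * r)"
    using inverse_one_minus_power [of "2 * r"] assms by simp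
  also have "\<dots> = (1 - q ^ (2 * r))\<^sup>2 * (q ^ (2 * r) * (inverse (1 - q ^ (2 * r)))\<^sup>2)"
    by (simp only: power_mult_distrib mult_ac)
  finally show "agree (Suc n) ((1 - q ^ (2 * r))\<^sup>2 * (q ^ (2 * r) * (inverse (1 - q ^ (2 * r)))\<^sup>2))
     ((1 - q ^ (2 * r))\<^sup>2 * (\<Sum>i=1..n. of_nat i * q ^ (2 * r * i)))"
    unfolding s_def by (rule agree_sym)
  show "fps_nth ((1 - q ^ (2 * r))\<^sup>2) 0 \<noteq> 0"
    using assms by (simp add: fps_nth_power_0 power_0_left)
qed

text \<open>For odd \<open>u\<close> all three sums coincide. For \<open>u = 2 v\<close> the odd
  divisors are those of \<open>v\<close>, the even ones are the doubled divisors of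
  \<open>v\<close>, and cofactors double, so the claim follows from the one for
  \<open>v\<close>.\<close>

lemma divisor_sum_odd_part:
  assumes "u > 0"
  shows "(\<Sum>d | d dvd u. int d) + (\<Sum>e | e dvd u \<and> odd e. int e - 2 * int (u div e)) = 0"
  using assms
proof (induction u rule: less_induct)
  case (less u)
  define D where "D v = (\<Sum>d | d dvd v. int d)" for v :: nat
  define O1 where "O1 v = (\<Sum>e | e dvd v \<and> odd e. int e)" for v :: nat
  define O2 where "O2 v = (\<Sum>e | e dvd v \<and> odd e. int (v div e))" for v :: nat
  have split: "(\<Sum>e | e dvd v \<and> odd e. int e - 2 * int (v div e)) = O1 v - 2 * O2 v" for v
    by (simp add: O1_def O2_def sum_subtractf sum_distrib_left)
  have "D u + O1 u - 2 * O2 u = 0"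
  proof (cases "even u")
    case False
    then have odd: "{e. e dvd u \<and> odd e} = {d. d dvd u}"
      using dvd_trans by blast
    have "O2 u = D u"
      unfolding O2_def D_def odd using less.prems
      by (intro sum.reindex_bij_witness [of _ "\<lambda>d. u div d" "\<lambda>d. u div d"])
         (auto elim!: dvdE)
    moreover have "O1 u = D u"
      unfolding O1_def D_def odd ..
    ultimately show ?thesis by simp
  next
    case True
    then obtain v where u: "u = 2 * v" by (rule evenE)
    with less.prems have v: "v > 0" "v < u" by auto
    have odd: "{e. e dvd u \<and> odd e} = {e. e dvd v \<and> odd e}"
      unfolding u by (auto simp: coprime_dvd_mult_right_iff)
    have fin: "finite {d. d dvd u}" "finite {d. d dvd v}"
      using less.prems v by simp_all
    have "D u = (\<Sum>d \<in> {e. e dvd u \<and> odd e} \<union> (*) 2 ` {d. d dvd v}. int d)"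
      unfolding D_def u by (intro sum.cong) (auto elim!: evenE)
    also have "\<dots> = O1 u + (\<Sum>d \<in> (*) 2 ` {d. d dvd v}. int d)"
      unfolding O1_def using fin by (intro sum.union_disjoint) auto
    also have "(\<Sum>d \<in> (*) 2 ` {d. d dvd v}. int d) = 2 * D v"
      by (subst sum.reindex) (auto simp: inj_on_def D_def sum_distrib_left)
    finally have "D u = O1 u + 2 * D v" .
    moreover have "O1 u = O1 v"
      unfolding O1_def odd ..
    moreover have "O2 u = 2 * O2 v"
      unfolding O2_def odd sum_distrib_left by (intro sum.cong) (simp_all add: u div_mult_swap [symmetric])
    moreover have "D v + (O1 v - 2 * O2 v) = 0"
      using less.IH [OF v(2,1)] unfolding split D_def .
    ultimately show ?thesis by simp
  qed
  then show ?case
    unfolding split D_def by simp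
qed


text \<open>\<open>t = r (r + 2 i + 1)\<close> splits \<open>t\<close> into factors of opposite
  parity with \<open>r\<close> the smaller. If \<open>e\<close> is the odd one, the sign
  \<open>(-1)^r\<close> tells whether it is the larger, so
  \<open>(-1)^r (2 i + 1) = e - t / e\<close>.\<close>

lemma odd_factor_pairs:
  assumes "t > 0" "t \<le> n"
  shows "(\<Sum>(r, i) \<in> {(r, i). r \<in> {1..n} \<and> i \<le> n \<and> r\<^sup>2 + r * (2 * i + 1) = t}. (- 1) ^ r * int (2 * i + 1))
     = (\<Sum>e | e dvd t \<and> odd e \<and> even (t div e). int e - int (t div e))"
proof (rule sum.reindex_bij_witness [of _
      "\<lambda>e. (min e (t div e), (max e (t div e) - min e (t div e) - 1) div 2)"
      "\<lambda>(r, i). if even r then r + 2 * i + 1 else r"])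
  fix p assume p: "p \<in> {(r, i). r \<in> {1..n} \<and> i \<le> n \<and> r\<^sup>2 + r * (2 * i + 1) = t}"
  obtain r i where ri: "p = (r, i)" by (cases p)
  with p have r: "r > 0" and t: "t = r * (r + 2 * i + 1)"
    by (auto simp: power2_eq_square algebra_simps)
  have dvd: "r + 2 * i + 1 dvd t" "r dvd t"
    unfolding t by (rule dvd_triv_right, rule dvd_triv_left)
  have div: "t div (r + 2 * i + 1) = r" "t div r = r + 2 * i + 1"
    unfolding t using r by (auto simp only: nonzero_mult_div_cancel_right nonzero_mult_div_cancel_left)
  show "(min (case p of (r, i) \<Rightarrow> if even r then r + 2 * i + 1 else r)
      (t div (case p of (r, i) \<Rightarrow> if even r then r + 2 * i + 1 else r)),
      (max (case p of (r, i) \<Rightarrow> if even r then r + 2 * i + 1 else r)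
      (t div (case p of (r, i) \<Rightarrow> if even r then r + 2 * i + 1 else r)) -
      min (case p of (r, i) \<Rightarrow> if even r then r + 2 * i + 1 else r)
      (t div (case p of (r, i) \<Rightarrow> if even r then r + 2 * i + 1 else r)) - 1) div 2) = p"
    using div by (simp add: ri)
  show "(case p of (r, i) \<Rightarrow> if even r then r + 2 * i + 1 else r) \<in> {e. e dvd t \<and> odd e \<and> even (t div e)}"
    using div dvd by (auto simp: ri)
  show "int (case p of (r, i) \<Rightarrow> if even r then r + 2 * i + 1 else r) -
      int (t div (case p of (r, i) \<Rightarrow> if even r then r + 2 * i + 1 else r)) =
      (case p of (r, i) \<Rightarrow> (- 1) ^ r * int (2 * i + 1))"
    using div by (simp add: ri)
next
  fix e assume e: "e \<in> {e. e dvd t \<and> odd e \<and> even (t div e)}"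
  define d where "d = t div e"
  have t: "t = d * e" and d: "even d" "odd e" "d > 0" "e > 0"
    using e assms by (auto simp: d_def elim!: dvdE)
  have ne: "d \<noteq> e" using d by auto
  define r where "r = min e d"
  define i where "i = (max e d - min e d - 1) div 2"
  have m: "max e d = r + 2 * i + 1"
    unfolding r_def i_def using d ne by (auto simp: max_def min_def)
  have t': "t = r * (r + 2 * i + 1)"
    using m unfolding r_def t by (auto simp: max_def min_def split: if_splits)
  have er: "(if even r then r + 2 * i + 1 else r) = e"
    using m d unfolding r_def by (auto simp: max_def min_def split: if_splits)
  have r: "r > 0"
    using d by (simp add: r_def)
  then have "1 * (r + 2 * i + 1) \<le> r * (r + 2 * i + 1)"
    by (intro mult_right_mono) auto
  then have "r + 2 * i + 1 \<le> t"
    unfolding t' [symmetric] by simp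
  with r have "(r, i) \<in> {(r, i). r \<in> {1..n} \<and> i \<le> n \<and> r\<^sup>2 + r * (2 * i + 1) = t}"
    using assms t' by (auto simp: power2_eq_square algebra_simps)
  then show "(min e (t div e), (max e (t div e) - min e (t div e) - 1) div 2)
      \<in> {(r, i). r \<in> {1..n} \<and> i \<le> n \<and> r\<^sup>2 + r * (2 * i + 1) = t}"
    by (simp only: r_def i_def d_def)
  show "(case (min e (t div e), (max e (t div e) - min e (t div e) - 1) div 2) of
      (r, i) \<Rightarrow> if even r then r + 2 * i + 1 else r) = e"
    using er by (simp only: r_def i_def d_def prod.case)
qed

lemma factor_pairs:
  assumes "u > 0" "u \<le> n"
  shows "(\<Sum>(N, i) \<in> {(N, i). N \<in> {1..2*n} \<and> i \<in> {1..n} \<and> N * i = u}. int i) = (\<Sum>d | d dvd u. int d)"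
  by (rule sum.reindex_bij_witness [of _ "\<lambda>d. (u div d, d)" snd])
     (use assms in \<open>auto intro: order_trans [OF dvd_imp_le] simp: dvd_imp_le div_le_dividend Suc_le_eq div_greater_zero_iff
        intro!: order_trans [OF div_le_dividend]\<close>)

lemma of_int_mult_qpow_nth: "fps_nth (of_int c * q ^ k) t = (if t = k then of_int c else 0)"
  unfolding fps_of_int [symmetric] by simp

text \<open>At \<open>t = 2 u\<close> the coefficient is the identity
  \<open>divisor_sum_odd_part\<close>. At odd \<open>t\<close> both sums are empty: exponents of the
  first are even, and \<open>r (r + 2 i + 1)\<close> is always even.\<close>

lemma lambert_cancel:
  "agree (Suc n)
     ((\<Sum>N=1..2*n. \<Sum>i=1..n. of_nat i * q ^ (2 * N * i))
       + (\<Sum>r=1..n. \<Sum>i\<le>n. (- 1) ^ r * (of_nat (2 * i + 1) * q ^ (r\<^sup>2 + r * (2 * i + 1))))) 0"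
  (is "agree _ (?a + ?b) 0")
proof (rule agreeI_nth)
  fix t assume "t < Suc n"
  then have t: "t \<le> n" by simp
  define P where "P = {(N, i). N \<in> {1..2*n} \<and> i \<in> {1..n} \<and> 2 * N * i = t}"
  define Q where "Q = {(r, i). r \<in> {1..n} \<and> i \<le> n \<and> r\<^sup>2 + r * (2 * i + 1) = t}"
  have "fps_nth ?a t = (\<Sum>p\<in>{1..2*n} \<times> {1..n}. if p \<in> P then of_int (int (snd p)) else 0)"
    unfolding sum.cartesian_product fps_sum_nth
    by (intro sum.cong) (auto simp: P_def fps_X_power_iff fps_mult_of_nat_nth split: if_splits)
  also have "\<dots> = (\<Sum>p\<in>({1..2*n} \<times> {1..n}) \<inter> P. of_int (int (snd p)))"
    by (rule sum.inter_restrict [symmetric]) simp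
  also have "({1..2*n} \<times> {1..n}) \<inter> P = P"
    by (auto simp: P_def)
  finally have a: "fps_nth ?a t = of_int (\<Sum>p\<in>P. int (snd p))"
    by simp
  have "fps_nth ?b t = (\<Sum>p\<in>{1..n} \<times> {..n}. if p \<in> Q then of_int ((- 1) ^ fst p * int (2 * snd p + 1)) else 0)"
    unfolding sum.cartesian_product fps_sum_nth
  proof (intro sum.cong refl)
    fix p assume p: "p \<in> {1..n} \<times> {..n}"
    obtain r i where ri: "p = (r, i)" by (cases p)
    have "(- 1) ^ r * (of_nat (2 * i + 1) * q ^ (r\<^sup>2 + r * (2 * i + 1)))
       = of_int ((- 1) ^ r * int (2 * i + 1)) * q ^ (r\<^sup>2 + r * (2 * i + 1))"
      by simp
    then show "fps_nth (case p of (r, i) \<Rightarrow> (- 1) ^ r * (of_nat (2 * i + 1) * q ^ (r\<^sup>2 + r * (2 * i + 1)))) t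
        = (if p \<in> Q then of_int ((- 1) ^ fst p * int (2 * snd p + 1)) else 0)"
      using p unfolding ri prod.case Q_def by (simp only: of_int_mult_qpow_nth) auto
  qed
  also have "\<dots> = (\<Sum>p\<in>({1..n} \<times> {..n}) \<inter> Q. of_int ((- 1) ^ fst p * int (2 * snd p + 1)))"
    by (rule sum.inter_restrict [symmetric]) simp
  also have "({1..n} \<times> {..n}) \<inter> Q = Q"
    by (auto simp: Q_def)
  finally have b: "fps_nth ?b t = of_int (\<Sum>p\<in>Q. (- 1) ^ fst p * int (2 * snd p + 1))"
    by simp
  have "(\<Sum>p\<in>P. int (snd p)) + (\<Sum>p\<in>Q. (- 1) ^ fst p * int (2 * snd p + 1)) = 0"
  proof (cases "t = 0")
    case True
    then have "P = {}" "Q = {}" by (auto simp: P_def Q_def)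
    then show ?thesis by simp
  next
    case False
    have Q: "(\<Sum>p\<in>Q. (- 1) ^ fst p * int (2 * snd p + 1))
        = (\<Sum>e | e dvd t \<and> odd e \<and> even (t div e). int e - int (t div e))"
      using odd_factor_pairs [OF _ t] False unfolding Q_def by (simp add: case_prod_beta)
    show ?thesis
    proof (cases "even t")
      case True
      then obtain u where u: "t = 2 * u" by (rule evenE)
      have P: "P = {(N, i). N \<in> {1..2*n} \<and> i \<in> {1..n} \<and> N * i = u}"
        by (auto simp: P_def u)
      have "(\<Sum>p\<in>P. int (snd p)) = (\<Sum>d | d dvd u. int d)"
        using factor_pairs [of u n] False t u unfolding P by (simp add: case_prod_beta)
      moreover have "{e. e dvd t \<and> odd e \<and> even (t div e)} = {e. e dvd u \<and> odd e}"
        unfolding u by (auto simp: coprime_dvd_mult_right_iff div_mult_swap [symmetric])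
      moreover have "(\<Sum>e | e dvd u \<and> odd e. int e - int (t div e)) = (\<Sum>e | e dvd u \<and> odd e. int e - 2 * int (u div e))"
        by (intro sum.cong) (simp_all add: u div_mult_swap [symmetric])
      ultimately show ?thesis
        using divisor_sum_odd_part [of u] False u Q by simp
    next
      case odd: False
      then have "P = {}" by (auto simp: P_def)
      moreover have e: "{e. e dvd t \<and> odd e \<and> even (t div e)} = {}"
        using odd by (auto elim!: dvdE split: if_splits)
      ultimately show ?thesis unfolding Q e by simp
    qed
  qed
  then show "fps_nth (?a + ?b) t = fps_nth 0 t"
    unfolding fps_add_nth a b by (simp only: of_int_add [symmetric] of_int_0 fps_zero_nth)
qed


lemma qcoth_square:
  assumes "r > 0"
  shows "qcoth r * qcoth r - 1 = 4 * (q ^ (2 * r) * (inverse (1 - q ^ (2 * r)))\<^sup>2)"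
proof -
  have "(1 + x) * k * ((1 + x) * k) - 1 = 4 * (x * k\<^sup>2)" if "(1 - x) * k = 1" for x k :: "rat fps"
    using that by algebra
  then show ?thesis
    unfolding qcoth_def using inverse_one_minus_power [of "2 * r"] assms by simp
qed

text \<open>Expands \<open>1 / (1 + x) = (1 - x) / (1 - x^2)\<close>, so that the signed terms of
  both Lambert series merge into one series over odd multiples.\<close>

lemma lambert_term:
  assumes "r > 0"
  shows "2 * (q ^ (2 * r) * (inverse (1 - q ^ (2 * r)))\<^sup>2) + q ^ r * (inverse (1 + q ^ r))\<^sup>2
     = q ^ r * (1 + q ^ (2 * r)) * (inverse (1 - q ^ (2 * r)))\<^sup>2"
proof -
  have "2 * (x\<^sup>2 * k\<^sup>2) + x * i\<^sup>2 = x * (1 + x\<^sup>2) * k\<^sup>2"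
    if k: "(1 - x\<^sup>2) * k = 1" and i: "(1 + x) * i = 1" for x k i :: "rat fps"
  proof -
    have "i = i * ((1 - x\<^sup>2) * k)"
      using k by simp
    also have "\<dots> = (1 + x) * i * (1 - x) * k"
      by (simp add: algebra_simps power2_eq_square)
    finally have "i = (1 - x) * k"
      using i by simp
    then show ?thesis by algebra
  qed
  moreover have "q ^ (2 * r) = (q ^ r)\<^sup>2"
    by (simp add: power_mult [symmetric] mult.commute)
  ultimately show ?thesis
    using inverse_one_minus_power [of "2 * r"] inverse_one_plus_power [of r] assms by simp
qed

text \<open>The two sides differ by 8 times the double series of \<open>lambert_cancel\<close>; 8 is
  2 times the 4 from \<open>coth^2 - 1\<close>.\<close>

lemma lambert_eq:
  "agree (Suc n) (1 - 2 * (\<Sum>N=1..2*n. qcoth N * qcoth N - 1)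
        - 4 * (\<Sum>m=1..n. (- 1) ^ m * q ^ (m\<^sup>2) * (qcoth m * qcoth m - 1))) (lambert n)"
proof -
  define b where "b N = q ^ (2 * N) * (inverse (1 - q ^ (2 * N)))\<^sup>2" for N
  define i where "i r = q ^ r * (inverse (1 + q ^ r))\<^sup>2" for r
  define c where "c r = (- 1) ^ r * q ^ (r\<^sup>2)" for r
  have 1: "(\<Sum>N=1..2*n. qcoth N * qcoth N - 1) = 4 * (\<Sum>N=1..2*n. b N)"
    unfolding sum_distrib_left b_def by (intro sum.cong refl qcoth_square) auto
  have 2: "(\<Sum>m=1..n. (- 1) ^ m * q ^ (m\<^sup>2) * (qcoth m * qcoth m - 1)) = 4 * (\<Sum>m=1..n. c m * b m)"
    unfolding sum_distrib_left
  proof (intro sum.cong refl)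
    fix m assume "m \<in> {1..n}"
    then have "qcoth m * qcoth m - 1 = 4 * b m"
      unfolding b_def by (intro qcoth_square) simp
    then show "(- 1) ^ m * q ^ (m\<^sup>2) * (qcoth m * qcoth m - 1) = 4 * (c m * b m)"
      by (simp add: c_def)
  qed
  have 3: "lambert n = 1 + 8 * (\<Sum>r=1..n. c r * i r)"
    by (simp add: lambert_def c_def i_def power_add mult_ac)
  have 4: "1 - 2 * (4 * (\<Sum>N=1..2*n. b N)) - 4 * (4 * (\<Sum>m=1..n. c m * b m))
     = lambert n - 8 * ((\<Sum>N=1..2*n. b N) + (\<Sum>r=1..n. c r * (2 * b r + i r)))"
    unfolding 3 by (simp add: sum.distrib sum_distrib_left algebra_simps)
  have "agree (Suc n) ((\<Sum>N=1..2*n. b N) + (\<Sum>r=1..n. c r * (2 * b r + i r)))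
     ((\<Sum>N=1..2*n. \<Sum>i=1..n. of_nat i * q ^ (2 * N * i))
       + (\<Sum>r=1..n. c r * (\<Sum>i\<le>n. of_nat (2 * i + 1) * q ^ (r * (2 * i + 1)))))"
    unfolding b_def i_def
  proof (intro agree_add agree_sum agree_mult_left lambert_expansion)
    fix r assume "r \<in> {1..n}"
    then have r: "r > 0" by simp
    show "agree (Suc n) (2 * (q ^ (2 * r) * (inverse (1 - q ^ (2 * r)))\<^sup>2) + q ^ r * (inverse (1 + q ^ r))\<^sup>2)
      (\<Sum>i\<le>n. of_nat (2 * i + 1) * q ^ (r * (2 * i + 1)))"
      unfolding lambert_term [OF r] by (rule odd_lambert_expansion [OF r])
  qed auto
  also have "(\<Sum>r=1..n. c r * (\<Sum>i\<le>n. of_nat (2 * i + 1) * q ^ (r * (2 * i + 1))))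
     = (\<Sum>r=1..n. \<Sum>i\<le>n. (- 1) ^ r * (of_nat (2 * i + 1) * q ^ (r\<^sup>2 + r * (2 * i + 1))))"
    unfolding sum_distrib_left c_def power_add [of _ "_\<^sup>2"]
    by (intro sum.cong refl) (simp only: mult_ac)
  also note lambert_cancel
  finally have "agree (Suc n) (lambert n - 8 * ((\<Sum>N=1..2*n. b N) + (\<Sum>r=1..n. c r * (2 * b r + i r)))) (lambert n - 8 * 0)"
    by (intro agree_diff agree_mult_left agree_refl)
  then show ?thesis
    unfolding 1 2 4 by simp
qed

lemma alt_sum_hecke: "agree (Suc n) (alt_sum n) (1 - (\<Sum>N=1..2*n. qcoth N * hecke N - 2))"
proof (rule agree_cancel_left)
  show "agree (Suc n) (theta n * alt_sum n) (theta n * (1 - (\<Sum>N=1..2*n. qcoth N * hecke N - 2)))"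
    using theta_alt_sum [of n] theta_sum_hecke [of n] lambert_eq [of n]
    by (meson agree_sym agree_trans)
  have "fps_nth (theta n) 0 = fps_nth (1 :: rat fps) 0 + 2 * (\<Sum>r=1..n. fps_nth (of_int ((- 1) ^ r) * q ^ (r\<^sup>2)) 0)"
    by (simp add: theta_def fps_sum_nth numeral_fps_const)
  also have "(\<Sum>r=1..n. fps_nth (of_int ((- 1) ^ r) * q ^ (r\<^sup>2)) 0) = 0"
    unfolding of_int_mult_qpow_nth by (intro sum.neutral) auto
  finally show "fps_nth (theta n) 0 \<noteq> 0"
    by simp
qed

section \<open>From the double sum to weighted triples\<close>

lemma qcoth_expansion:
  assumes "N > 0"
  shows "agree (Suc n) (qcoth N) (\<Sum>z\<le>n. of_int (2 - of_bool (z = 0)) * q ^ (2 * N * z))"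
proof (rule agree_cancel_left)
  define x where "x = q ^ (2 * N)"
  define s where "s n = (\<Sum>z\<le>n. of_int (2 - of_bool (z = 0)) * x ^ z)" for n :: nat
  have 1: "(1 - x) * s n = 1 + x - 2 * x ^ Suc n" for n
  proof (induction n)
    case (Suc n)
    have "s (Suc n) = s n + 2 * x ^ Suc n"
      by (simp add: s_def)
    then have "(1 - x) * s (Suc n) = (1 - x) * s n + (1 - x) * (2 * x ^ Suc n)"
      by (simp only: distrib_left)
    then show ?case
      unfolding Suc by (simp add: algebra_simps)
  qed (simp add: s_def)
  have 2: "agree (Suc n) (1 + x - 2 * x ^ Suc n) (1 + x - 2 * 0)"
  proof (intro agree_diff agree_mult_left agree_refl)
    have "Suc n \<le> 2 * N * Suc n"
      using assms by (cases N) auto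
    then show "agree (Suc n) (x ^ Suc n) 0"
      unfolding x_def power_mult [symmetric] by (rule agree_power_0)
  qed
  have 3: "(1 - x) * qcoth N = 1 + x"
    unfolding x_def by (rule qcoth_mult [OF assms])
  have 4: "s n = (\<Sum>z\<le>n. of_int (2 - of_bool (z = 0)) * q ^ (2 * N * z))"
    by (simp only: s_def x_def power_mult)
  show "agree (Suc n) ((1 - x) * qcoth N) ((1 - x) * (\<Sum>z\<le>n. of_int (2 - of_bool (z = 0)) * q ^ (2 * N * z)))"
    unfolding 4 [symmetric] 1 3 using agree_sym [OF 2] by simp
  show "fps_nth (1 - x) 0 \<noteq> 0"
    unfolding x_def using assms by (simp add: power_0_left)
qed

text \<open>With \<open>y = N + j\<close> the exponent factors as
  \<open>N^2 - j^2 = (2 N - y) y\<close>, ready for \<open>x = 2 N - y\<close>.\<close>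

lemma hecke_eq:
  assumes "N > 0"
  shows "hecke N = (\<Sum>y\<le>2*N. of_int ((2 - of_bool (y = 0) - of_bool (y = 2 * N)) * (- 1) ^ y) * q ^ ((2 * N - y) * y))"
proof -
  define f where "f y = hecke_term N (int y - int N)" for y
  have f: "f y = (- 1) ^ y * q ^ ((2 * N - y) * y)" if "y \<le> 2 * N" for y
  proof -
    have "(int N)\<^sup>2 - (int y - int N)\<^sup>2 = int ((2 * N - y) * y)"
      using that by (simp add: of_nat_diff power2_eq_square algebra_simps)
    then show ?thesis
      by (simp add: f_def hecke_term_def qpow_def del: of_nat_mult)
  qed
  have "hecke N = (\<Sum>y<2*N. f y + f (Suc y))"
    unfolding hecke_def
    by (rule sum.reindex_bij_witness [of _ "\<lambda>y. int y - int N" "\<lambda>j. nat (j + int N)"])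
       (auto simp: f_def algebra_simps)
  also have "\<dots> = (\<Sum>y<2*N. f y) + (\<Sum>y<2*N. f (Suc y))"
    by (rule sum.distrib)
  also have "(\<Sum>y<2*N. f y) = (\<Sum>y\<le>2*N. f y) - f (2 * N)"
    by (simp flip: lessThan_Suc_atMost)
  also have "(\<Sum>y<2*N. f (Suc y)) = (\<Sum>y\<le>2*N. f y) - f 0"
    by (simp add: sum.atMost_shift)
  also have "(\<Sum>y\<le>2*N. f y) - f (2 * N) + ((\<Sum>y\<le>2*N. f y) - f 0)
      = (\<Sum>y\<le>2*N. 2 * f y - (if y = 0 then f y else 0) - (if y = 2 * N then f y else 0))"
    by (simp add: sum_subtractf sum_distrib_left [symmetric])
  also have "\<dots> = (\<Sum>y\<le>2*N. of_int ((2 - of_bool (y = 0) - of_bool (y = 2 * N)) * (- 1) ^ y) * q ^ ((2 * N - y) * y))"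
    using assms by (intro sum.cong) (auto simp: f)
  finally show ?thesis .
qed

text \<open>The expansion of \<open>qcoth N\<close> supplies \<open>z\<close> with half weight at
  \<open>z = 0\<close>. With \<open>x = 2 N - y\<close> the exponent is
  \<open>x y + (x + y) z\<close>, and \<open>x + y = 2 N\<close> is the equal-parity condition. The
  constants \<open>- 2\<close> do not reach a positive index.\<close>

lemma fps_nth_hecke_sum:
  assumes "n > 0"
  shows "fps_nth (1 - (\<Sum>N=1..2*n. qcoth N * hecke N - 2)) n
     = of_int ((- 1) ^ Suc n * 2 * wcount n (\<lambda>x y z. even x \<longleftrightarrow> even y))"
proof -
  define v where "v z = (2 - of_bool (z = 0) :: int)" for z :: nat
  define w where "w N y = ((2 - of_bool (y = 0) - of_bool (y = 2 * N)) * (- 1) ^ y :: int)" for N y :: nat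
  define e where "e N z y = (2 * N - y) * y + 2 * N * z" for N z y :: nat
  define I where "I = (SIGMA N:{1..2*n}. {..n} \<times> {..2*N})"
  have "fps_nth (qcoth N * hecke N) n = (\<Sum>(z, y) \<in> {..n} \<times> {..2*N}. if e N z y = n then of_int (v z * w N y) else 0)"
    if "N \<in> {1..2*n}" for N
  proof -
    have N: "N > 0" using that by simp
    have "agree (Suc n) (qcoth N * hecke N)
       ((\<Sum>z\<le>n. of_int (v z) * q ^ (2 * N * z)) * (\<Sum>y\<le>2*N. of_int (w N y) * q ^ ((2 * N - y) * y)))"
      unfolding hecke_eq [OF N] v_def w_def by (intro agree_mult agree_refl qcoth_expansion N)
    also have "\<dots> = (\<Sum>(z, y) \<in> {..n} \<times> {..2*N}. of_int (v z * w N y) * q ^ e N z y)"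
      unfolding sum_product sum.cartesian_product e_def power_add
      by (intro sum.cong refl) (auto simp: mult_ac)
    finally have "fps_nth (qcoth N * hecke N) n = fps_nth (\<Sum>(z, y) \<in> {..n} \<times> {..2*N}. of_int (v z * w N y) * q ^ e N z y) n"
      by (rule agree_nth) simp
    also have "\<dots> = (\<Sum>(z, y) \<in> {..n} \<times> {..2*N}. if e N z y = n then of_int (v z * w N y) else 0)"
      unfolding fps_sum_nth case_prod_beta by (intro sum.cong refl) (simp only: of_int_mult_qpow_nth eq_commute [of n])
    finally show ?thesis .
  qed
  then have "(\<Sum>N=1..2*n. fps_nth (qcoth N * hecke N) n)
     = (\<Sum>N=1..2*n. \<Sum>p \<in> {..n} \<times> {..2*N}. if e N (fst p) (snd p) = n then of_int (v (fst p) * w N (snd p)) else 0)"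
    by (intro sum.cong refl) (simp add: case_prod_beta)
  also have "\<dots> = (\<Sum>p\<in>I. if e (fst p) (fst (snd p)) (snd (snd p)) = n then of_int (v (fst (snd p)) * w (fst p) (snd (snd p))) else 0)"
    unfolding I_def by (subst sum.Sigma) (auto simp: case_prod_beta)
  also have "\<dots> = (\<Sum>p\<in>{p\<in>I. e (fst p) (fst (snd p)) (snd (snd p)) = n}. of_int (v (fst (snd p)) * w (fst p) (snd (snd p))))"
    by (rule sum.inter_filter [symmetric]) (simp add: I_def)
  also have "\<dots> = (\<Sum>(x, y, z) \<in> triples n (\<lambda>x y z. even x \<longleftrightarrow> even y). of_int ((- 1) ^ n * 2 * wt x y z))"
  proof (rule sum.reindex_bij_witness [of _ "\<lambda>(x, y, z). ((x + y) div 2, z, y)" "\<lambda>(N, z, y). (2 * N - y, y, z)"])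
    fix p assume p: "p \<in> {p\<in>I. e (fst p) (fst (snd p)) (snd (snd p)) = n}"
    obtain N z y where Nzy: "p = (N, z, y)" by (cases p)
    with p have h: "N \<ge> 1" "y \<le> 2 * N" "(2 * N - y) * y + 2 * N * z = n"
      by (auto simp: I_def e_def)
    define x where "x = 2 * N - y"
    have N: "2 * N = x + y" using h by (simp add: x_def)
    have n: "x * y + y * z + z * x = n"
      using h(3) unfolding N by (simp add: algebra_simps)
    have par: "even x \<longleftrightarrow> even y"
      using N by presburger
    \<comment> \<open>For \<open>x\<close> and \<open>y\<close> of equal parity
      \<open>z (x + y)\<close> is even, so \<open>n\<close> has the parity of \<open>x y\<close>,
      hence of \<open>y\<close>.\<close>
    then have sgn: "(- 1) ^ y = ((- 1) ^ n :: int)"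
      unfolding n [symmetric] by (cases "even y") simp_all
    show "(case case p of (N, z, y) \<Rightarrow> (2 * N - y, y, z) of (x, y, z) \<Rightarrow> ((x + y) div 2, z, y)) = p"
      using h by (simp add: Nzy)
    show "(case p of (N, z, y) \<Rightarrow> (2 * N - y, y, z)) \<in> triples n (\<lambda>x y z. even x \<longleftrightarrow> even y)"
      using n par by (simp add: Nzy triples_def x_def [symmetric])
    \<comment> \<open>At most one entry is zero since \<open>n > 0\<close>; only then does the
      product of the two weights equal twice the linear expression \<open>wt\<close>.\<close>
    have "v z * (2 - of_bool (y = 0) - of_bool (y = 2 * N)) = 2 * wt x y z"
      using n assms h(1) N by (auto simp: v_def wt_def)
    then have "v z * w N y = (- 1) ^ n * 2 * wt x y z"
      unfolding w_def sgn by (simp add: mult_ac)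
    then show "(case case p of (N, z, y) \<Rightarrow> (2 * N - y, y, z) of (x, y, z) \<Rightarrow> of_int ((- 1) ^ n * 2 * wt x y z))
       = of_int (v (fst (snd p)) * w (fst p) (snd (snd p)))"
      by (simp only: Nzy prod.case fst_conv snd_conv x_def [symmetric])
  next
    fix t assume t: "t \<in> triples n (\<lambda>x y z. even x \<longleftrightarrow> even y)"
    obtain x y z where xyz: "t = (x, y, z)" by (cases t)
    with t have h: "even x \<longleftrightarrow> even y" "x * y + y * z + z * x = n"
      by (auto simp: triples_def)
    have le: "x \<le> n" "y \<le> n" "z \<le> n"
      using triples_le t assms unfolding xyz by blast+
    define N where "N = (x + y) div 2"
    have N: "2 * N = x + y" using h(1) by (simp add: N_def)
    have "N > 0"
      using N h(2) assms by (cases "N = 0") auto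
    moreover have "e N z y = n"
      unfolding e_def N using h(2) by (simp add: algebra_simps)
    ultimately show "(case t of (x, y, z) \<Rightarrow> ((x + y) div 2, z, y)) \<in> {p\<in>I. e (fst p) (fst (snd p)) (snd (snd p)) = n}"
      using le N by (simp add: xyz I_def N_def [symmetric])
    show "(case case t of (x, y, z) \<Rightarrow> ((x + y) div 2, z, y) of (N, z, y) \<Rightarrow> (2 * N - y, y, z)) = t"
      using N by (simp add: xyz N_def [symmetric])
  qed
  also have "\<dots> = of_int ((- 1) ^ n * 2 * wcount n (\<lambda>x y z. even x \<longleftrightarrow> even y))"
    by (simp add: wcount_def sum_distrib_left case_prod_beta)
  finally have "(\<Sum>N=1..2*n. fps_nth (qcoth N * hecke N) n) = of_int ((- 1) ^ n * 2 * wcount n (\<lambda>x y z. even x \<longleftrightarrow> even y))" .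
  moreover have "fps_nth (1 - (\<Sum>N=1..2*n. qcoth N * hecke N - 2)) n = - (\<Sum>N=1..2*n. fps_nth (qcoth N * hecke N) n)"
    using assms by (simp add: fps_sum_nth numeral_fps_const)
  ultimately show ?thesis by simp
qed

section \<open>Overpartitions by largest part\<close>

definition parts_le :: "nat \<Rightarrow> nat \<Rightarrow> (nat multiset \<times> nat set) set" where
  "parts_le m n = {p \<in> overpartitions n. set_mset (fst p) \<subseteq> {..m}}"

definition signed_count :: "(nat multiset \<times> nat set) set \<Rightarrow> int" where
  "signed_count S = (\<Sum>p\<in>S. (- 1) ^ size (fst p))"

lemma finite_parts_le [simp]: "finite (parts_le m n)"
  unfolding parts_le_def using finite_overpartitions by simp

definition max_part :: "nat \<Rightarrow> nat \<Rightarrow> (nat multiset \<times> nat set) set" where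
  "max_part m n = {p \<in> parts_le m n. m \<in># fst p}"

lemma finite_max_part [simp]: "finite (max_part m n)"
  by (simp add: max_part_def)

lemma parts_le_Suc: "parts_le (Suc m) n = parts_le m n \<union> max_part (Suc m) n"
  "parts_le m n \<inter> max_part (Suc m) n = {}"
  by (auto simp: parts_le_def max_part_def le_Suc_eq)

lemma signed_count_parts_le_Suc:
  "signed_count (parts_le (Suc m) n) = signed_count (parts_le m n) + signed_count (max_part (Suc m) n)"
  unfolding signed_count_def parts_le_Suc(1) by (rule sum.union_disjoint) (simp_all add: parts_le_Suc(2))

lemma max_part_empty: "n < m \<Longrightarrow> max_part m n = {}"
  by (auto simp: max_part_def parts_le_def overpartitions_def dest!: multi_member_split)

text \<open>Removing one copy of \<open>m\<close> flips the sign. If \<open>m\<close> still occurs,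
  the overlining is kept (\<open>A\<close>); otherwise the removed copy was the only one and was
  plain (\<open>B\<close>) or overlined (\<open>C\<close>), whence the factor 2.\<close>

lemma max_part_split:
  assumes "m > 0"
  shows "signed_count (max_part m (n + m))
     = - signed_count (max_part m n) - 2 * signed_count (parts_le (m - 1) n)"
proof -
  define A where "A = (\<lambda>(P, L). (add_mset m P, L)) ` max_part m n"
  define B where "B = (\<lambda>(P, L). (add_mset m P, L)) ` parts_le (m - 1) n"
  define C where "C = (\<lambda>(P, L). (add_mset m P, insert m L)) ` parts_le (m - 1) n"
  have eq: "max_part m (n + m) = A \<union> B \<union> C"
  proof (rule set_eqI)
    fix p :: "nat multiset \<times> nat set"
    obtain P L where p: "p = (P, L)" by (cases p)
    show "p \<in> max_part m (n + m) \<longleftrightarrow> p \<in> A \<union> B \<union> C"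
    proof
      assume a: "p \<in> max_part m (n + m)"
      then obtain Q where Q: "P = add_mset m Q"
        by (auto simp: p max_part_def dest: multi_member_split)
      have h: "0 \<notin># Q" "sum_mset Q = n" "L \<subseteq> insert m (set_mset Q)" "set_mset Q \<subseteq> {..m}"
        using a assms by (auto simp: p Q max_part_def parts_le_def overpartitions_def)
      show "p \<in> A \<union> B \<union> C"
      proof (cases "m \<in># Q")
        case True
        then have "(Q, L) \<in> max_part m n"
          using h by (auto simp: max_part_def parts_le_def overpartitions_def)
        then show ?thesis by (force simp: A_def p Q)
      next
        case False
        have le: "set_mset Q \<subseteq> {..m - 1}"
        proof -
          have "x \<le> m - 1" if "x \<in># Q" for x
          proof -
            have "x \<le> m" "x \<noteq> m" using that h(4) False by auto
            then show ?thesis by simp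
          qed
          then show ?thesis by auto
        qed
        then have QL: "(Q, L - {m}) \<in> parts_le (m - 1) n"
          using h by (auto simp: parts_le_def overpartitions_def)
        show ?thesis
        proof (cases "m \<in> L")
          case True
          then have "L = insert m (L - {m})" by auto
          then have "p = (\<lambda>(P, L). (add_mset m P, insert m L)) (Q, L - {m})"
            by (simp add: p Q)
          then show ?thesis using QL unfolding C_def by blast
        next
          case False
          then have "p = (\<lambda>(P, L). (add_mset m P, L)) (Q, L - {m})"
            by (simp add: p Q)
          then show ?thesis using QL unfolding B_def by blast
        qed
      qed
    next
      assume "p \<in> A \<union> B \<union> C"
      then show "p \<in> max_part m (n + m)"
        using assms by (auto simp: A_def B_def C_def max_part_def parts_le_def overpartitions_def)
    qed
  qed
  have notin: "m \<notin># P" "m \<notin> L" if "(P, L) \<in> parts_le (m - 1) n" for P L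
    using that assms by (auto simp: parts_le_def overpartitions_def)
  have "count (fst p) m \<ge> 2" if "p \<in> A" for p
    using that by (auto simp: A_def max_part_def Suc_le_eq)
  moreover have B: "count (fst p) m = 1" "m \<notin> snd p" if "p \<in> B" for p
    using that notin by (auto simp: B_def not_in_iff)
  moreover have C: "count (fst p) m = 1" "m \<in> snd p" if "p \<in> C" for p
    using that notin by (auto simp: C_def not_in_iff)
  ultimately have AB: "A \<inter> B = {}" and ABC: "(A \<union> B) \<inter> C = {}"
    by fastforce+
  have fin: "finite A" "finite B" "finite C"
    by (simp_all add: A_def B_def C_def)
  have "signed_count (max_part m (n + m)) = signed_count A + signed_count B + signed_count C"
    unfolding eq signed_count_def using fin AB ABC by (simp add: sum.union_disjoint)
  also have "signed_count A = - signed_count (max_part m n)"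
    unfolding A_def signed_count_def
    by (subst sum.reindex) (auto simp: inj_on_def case_prod_beta sum_negf)
  also have "signed_count B = - signed_count (parts_le (m - 1) n)"
    unfolding B_def signed_count_def
    by (subst sum.reindex) (auto simp: inj_on_def case_prod_beta sum_negf)
  also have "signed_count C = - signed_count (parts_le (m - 1) n)"
  proof -
    have "inj_on (\<lambda>(P, L). (add_mset m P, insert m L)) (parts_le (m - 1) n)"
    proof (rule inj_onI)
      fix x y
      assume h: "x \<in> parts_le (m - 1) n" "y \<in> parts_le (m - 1) n"
        and "(\<lambda>(P, L). (add_mset m P, insert m L)) x = (\<lambda>(P, L). (add_mset m P, insert m L)) y"
      then have "insert m (snd x) = insert m (snd y)" "fst x = fst y"
        by (simp_all add: case_prod_beta)
      moreover have "m \<notin> snd x" "m \<notin> snd y"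
        using notin(2) [of "fst x"] notin(2) [of "fst y"] h by simp_all
      ultimately show "x = y"
        by (simp add: insert_ident prod_eq_iff)
    qed
    then show ?thesis
      unfolding C_def signed_count_def by (subst sum.reindex) (auto simp: case_prod_beta sum_negf)
  qed
  finally show ?thesis by simp
qed

lemma signed_count_recurrence:
  assumes "m > 0"
  shows "signed_count (parts_le m (n + m)) + signed_count (parts_le m n)
     = signed_count (parts_le (m - 1) (n + m)) - signed_count (parts_le (m - 1) n)"
  using max_part_split [OF assms, of n] signed_count_parts_le_Suc [of "m - 1" "n + m"]
    signed_count_parts_le_Suc [of "m - 1" n] assms by simp

lemma parts_le_0: "parts_le 0 n = (if n = 0 then {({#}, {})} else {})"
proof -
  have P: "P = {#}" if "(P, L) \<in> parts_le 0 n" for P L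
  proof (rule ccontr)
    assume "P \<noteq> {#}"
    then obtain x where "x \<in># P" by auto
    then show False
      using that by (auto simp: parts_le_def overpartitions_def)
  qed
  show ?thesis
  proof (cases "n = 0")
    case True
    have "({#}, {}) \<in> parts_le 0 n"
      by (simp add: parts_le_def overpartitions_def True)
    moreover have "p = ({#}, {})" if "p \<in> parts_le 0 n" for p
      using that P [of "fst p" "snd p"] by (auto simp: parts_le_def overpartitions_def prod_eq_iff)
    ultimately have "parts_le 0 n = {({#}, {})}" by blast
    then show ?thesis using True by simp
  next
    case False
    then have "p \<notin> parts_le 0 n" for p
      using P [of "fst p" "snd p"] by (auto simp: parts_le_def overpartitions_def)
    then have "parts_le 0 n = {}" by blast
    then show ?thesis using False by simp
  qed
qed

text \<open>Parts of size \<open>i\<close> contribute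
  \<open>1 - 2 q^i + 2 q^(2i) - ... = (1 - q^i) / (1 + q^i)\<close>. Instead of expanding products,
  both sides are matched through the recurrence in \<open>m\<close>, which determines the next
  series as \<open>1 + q ^ Suc m\<close> is cancellable.\<close>

lemma eta_quot_nth: "fps_nth (eta_quot m) n = of_int (signed_count (parts_le m n))"
proof -
  define f where "f m = Abs_fps (\<lambda>n. of_int (signed_count (parts_le m n)) :: rat)" for m
  have "eta_quot m = f m"
  proof (induction m)
    case 0
    show ?case
      by (rule fps_ext) (simp add: f_def parts_le_0 signed_count_def)
  next
    case (Suc m)
    have "(1 + q ^ Suc m) * f (Suc m) = (1 - q ^ Suc m) * f m"
    proof (rule fps_ext)
      fix n
      show "fps_nth ((1 + q ^ Suc m) * f (Suc m)) n = fps_nth ((1 - q ^ Suc m) * f m) n"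
      proof (cases "n < Suc m")
        case True
        then have "signed_count (parts_le (Suc m) n) = signed_count (parts_le m n)"
          unfolding signed_count_parts_le_Suc max_part_empty [OF True] by (simp add: signed_count_def)
        then show ?thesis
          using True by (simp add: distrib_right left_diff_distrib fps_X_power_mult_nth f_def del: power_Suc)
      next
        case False
        define k where "k = n - Suc m"
        with False have k: "n = k + Suc m" by simp
        have "of_int (signed_count (parts_le (Suc m) n) + signed_count (parts_le (Suc m) k))
          = (of_int (signed_count (parts_le m n) - signed_count (parts_le m k)) :: rat)"
          using signed_count_recurrence [of "Suc m" k] by (simp add: k)
        then show ?thesis
          using False
          by (simp add: distrib_right left_diff_distrib fps_X_power_mult_nth f_def k del: power_Suc)
      qed
    qed
    also have "\<dots> = (1 + q ^ Suc m) * eta_quot (Suc m)"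
      using eta_quot_Suc [of m] Suc by simp
    finally have "(1 + q ^ Suc m) * (f (Suc m) - eta_quot (Suc m)) = 0"
      by (simp add: right_diff_distrib del: power_Suc)
    moreover have "1 + q ^ Suc m \<noteq> 0"
      using nth_0_one_plus_power [of "Suc m"] by (metis fps_zero_nth zero_less_Suc zero_neq_one)
    ultimately show ?case by simp
  qed
  then show ?thesis by (simp add: f_def)
qed

lemma overpartitions_by_max:
  "overpartitions n = parts_le 0 n \<union> (\<Union>m\<in>{1..n}. max_part m n)"
proof
  show "overpartitions n \<subseteq> parts_le 0 n \<union> (\<Union>m\<in>{1..n}. max_part m n)"
  proof
    fix p assume p: "p \<in> overpartitions n"
    obtain P L where PL: "p = (P, L)" by (cases p)
    show "p \<in> parts_le 0 n \<union> (\<Union>m\<in>{1..n}. max_part m n)"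
    proof (cases "P = {#}")
      case True
      then show ?thesis using p by (simp add: PL parts_le_def)
    next
      case False
      define m where "m = Max (set_mset P)"
      have m: "m \<in># P" using False by (simp add: m_def)
      have "set_mset P \<subseteq> {..m}" by (auto simp: m_def)
      then have "p \<in> max_part m n"
        using p m by (simp add: PL max_part_def parts_le_def)
      moreover have "0 \<notin># P"
        using p by (simp add: PL overpartitions_def)
      then have "m \<noteq> 0"
        using m by metis
      moreover have "m \<le> n"
        using calculation max_part_empty [of n m] by (cases "n < m") auto
      ultimately show ?thesis by auto
    qed
  qed
qed (auto simp: parts_le_def max_part_def)

lemma max_part_Max:
  "(P, L) \<in> max_part m n \<Longrightarrow> Max (insert 0 (set_mset P)) = m"
  by (intro Max_eqI) (auto simp: max_part_def parts_le_def)

lemma rank_sign: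
  assumes "p \<in> max_part m n"
  shows "(if even (overpartition_rank p) then 1 else - 1 :: int) = (- 1) ^ m * (- 1) ^ size (fst p)"
  using assms max_part_Max [of "fst p" "snd p" m n] by (simp add: overpartition_rank_def minus_one_power_iff)

text \<open>On overpartitions with largest part \<open>m\<close> the rank sign is
  \<open>(-1)^m\<close> times the sign counted by \<open>u\<close>, and having largest part exactly
  \<open>m\<close> is the difference of two bounds. The empty overpartition, of even rank, is the
  leading 1.\<close>

lemma pbar_diff:
  "of_int (int (pbar_e n) - int (pbar_o n)) = fps_nth (alt_sum n) n"
proof -
  let ?s = "\<lambda>p. if even (overpartition_rank p) then 1 else - 1 :: int"
  have fin: "finite (overpartitions n)" by (rule finite_overpartitions)
  have "int (pbar_e n) - int (pbar_o n) = (\<Sum>p\<in>overpartitions n. ?s p)"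
    using fin by (simp add: pbar_e_def pbar_o_def sum.If_cases Int_def)
  also have "\<dots> = (\<Sum>p\<in>parts_le 0 n. ?s p) + (\<Sum>p\<in>(\<Union>m\<in>{1..n}. max_part m n). ?s p)"
    unfolding overpartitions_by_max
    by (rule sum.union_disjoint) (auto simp: parts_le_0 max_part_def)
  also have "(\<Sum>p\<in>(\<Union>m\<in>{1..n}. max_part m n). ?s p) = (\<Sum>m=1..n. \<Sum>p\<in>max_part m n. ?s p)"
  proof (rule sum.UNION_disjoint)
    show "\<forall>i\<in>{1..n}. \<forall>j\<in>{1..n}. i \<noteq> j \<longrightarrow> max_part i n \<inter> max_part j n = {}"
      by (auto simp: disjoint_iff dest!: max_part_Max)
  qed auto
  also have "\<dots> = (\<Sum>m=1..n. (- 1) ^ m * signed_count (max_part m n))"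
    unfolding signed_count_def sum_distrib_left by (intro sum.cong refl rank_sign)
  also have "(\<Sum>p\<in>parts_le 0 n. ?s p) = (if n = 0 then 1 else 0)"
    by (simp add: parts_le_0 overpartition_rank_def)
  finally have 1: "int (pbar_e n) - int (pbar_o n)
     = (if n = 0 then 1 else 0) + (\<Sum>m=1..n. (- 1) ^ m * signed_count (max_part m n))" .
  have "fps_nth ((- 1) ^ m * (eta_quot m - eta_quot (m - 1))) n = of_int ((- 1) ^ m * signed_count (max_part m n))"
    if "m \<in> {1..n}" for m
  proof -
    have "fps_nth (eta_quot m - eta_quot (m - 1)) n = of_int (signed_count (max_part m n))"
      using signed_count_parts_le_Suc [of "m - 1" n] that by (simp add: eta_quot_nth)
    then show ?thesis
      by (cases "even m") simp_all
  qed
  then show ?thesis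
    unfolding 1 alt_sum_def by (simp add: fps_sum_nth)
qed

lemma pbar_diff_eq_wcount:
  assumes "n > 0"
  shows "int (pbar_e n) - int (pbar_o n) = (- 1) ^ Suc n * 2 * wcount n (\<lambda>x y z. even x \<longleftrightarrow> even y)"
proof -
  have "of_int (int (pbar_e n) - int (pbar_o n))
      = fps_nth (1 - (\<Sum>N=1..2*n. qcoth N * hecke N - 2)) n"
    unfolding pbar_diff by (rule agree_nth [OF alt_sum_hecke]) simp
  then show ?thesis
    unfolding fps_nth_hecke_sum [OF assms] of_int_eq_iff .
qed

section \<open>The congruences\<close>

lemma pbar_cong:
  assumes "n > 0" and "wcount n (\<lambda>x y z. even x \<longleftrightarrow> even y) = K * c" and "M dvd K"
  shows "[int (pbar_e n) = int (pbar_o n)] (mod M)"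
  unfolding cong_iff_dvd_diff pbar_diff_eq_wcount [OF assms(1)] assms(2) using assms(3) by simp

theorem corollary1p4:
  shows
    "(\<forall>(a::nat) (M::int) (n::nat) (t::nat).
        a \<ge> 1 \<longrightarrow> M > 0 \<longrightarrow> M dvd 2 ^ (a + 2) - 3 \<longrightarrow> t \<in> {1, 2} \<longrightarrow>
        [int (pbar_e (4 ^ (a + 1) * n + t * 4 ^ a)) =
         int (pbar_o (4 ^ (a + 1) * n + t * 4 ^ a))] (mod M)) \<and>
     (\<forall>(a::nat) (M::int) (n::nat).
        a \<ge> 1 \<longrightarrow> M > 0 \<longrightarrow> M dvd 2 ^ (a + 1) - 1 \<longrightarrow>
        [int (pbar_e (2 * 4 ^ (a + 1) * n + 3 * 4 ^ a)) =
         int (pbar_o (2 * 4 ^ (a + 1) * n + 3 * 4 ^ a))] (mod M))"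
proof (intro conjI allI impI)
  fix a n t :: nat and M :: int
  assume M: "M dvd 2 ^ (a + 2) - 3" and t: "t \<in> {1, 2}"
  have e: "4 ^ (a + 1) * n + t * 4 ^ a = 4 ^ a * (4 * n + t)"
    by (simp add: algebra_simps)
  have "(4 * n + t) mod 4 = 1 \<or> (4 * n + t) mod 4 = 2"
    using t by auto
  then show "[int (pbar_e (4 ^ (a + 1) * n + t * 4 ^ a)) = int (pbar_o (4 ^ (a + 1) * n + t * 4 ^ a))] (mod M)"
    unfolding e using t M by (intro pbar_cong [OF _ count_power_4_mod_4]) auto
next
  fix a n :: nat and M :: int
  assume M: "M dvd 2 ^ (a + 1) - 1"
  have e: "2 * 4 ^ (a + 1) * n + 3 * 4 ^ a = 4 ^ a * (8 * n + 3)"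
    by (simp add: algebra_simps)
  have "(8 * n + 3) mod 8 = 3"
    by simp
  then show "[int (pbar_e (2 * 4 ^ (a + 1) * n + 3 * 4 ^ a)) = int (pbar_o (2 * 4 ^ (a + 1) * n + 3 * 4 ^ a))] (mod M)"
    unfolding e using M by (intro pbar_cong [OF _ count_power_4_mod_8]) auto
qed

end
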